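(* Let $\alpha,\beta>0$ be two positive integers, and let $\mathfrak{n}_{\alpha,\beta}\subset\mathbb{C}[x,y]$ be the normalisation of the ideal $(x^\alpha,y^\beta)$. Then $$\nu_{\mathbb{C}[x,y]/\mathfrak{n}_{\alpha,\beta}}=\frac{\alpha\cdot\beta}{\gcd(\alpha,\beta)}.$$
   Context: For a monomial ideal $I\subset\mathbb{C}[x,y]$ of finite colength, its normalisation is the monomial ideal $\overline{I}$ generated by all monomials $x^ay^b$ such that $(x^ay^b)^p\in I^p$ for some $p\geq1$. A fat point is a scheme $X=\operatorname{Spec}R$ of finite type over $\mathbb{C}$ with $R$ a local artinian $\mathbb{C}$-algebra. If $X\hookrightarrow\mathbb{A}^N$ is a closed embedding with ideal $I\subset A=\mathbb{C}[x_1,\ldots,x_N]$, let $C=\operatorname{Spec}\bigl(\bigoplus_{d\geq0}I^d/I^{d+1}\bigr)$ be its normal cone. The Behrend number of $X$ (denoted $\nu_X$, $\nu_R$ or $\nu_{A/I}$), i.e. the value of Behrend's constructible function at the unique point of $X$, is $$\nu_X=\sum_{D}\operatorname{length}_{\mathcal{O}_{C,D}}(\mathcal{O}_{C,D}),$$ the sum being over all irreducible components $D$ of $C$, where $\mathcal{O}_{C,D}$ is the local ring of $C$ at the generic point of $D$. This does not depend on the chosen embedding. *)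

theory Defs
  imports
    "HOL-Computational_Algebra.Polynomial"
    "HOL-Library.Extended_Nat"
    "HOL-Analysis.Abstract_Topology"
    "HOL-Algebra.QuotRing"
    "HOL-Algebra.Ideal_Product"
    "HOL-Algebra.Module"
    "HOL-Algebra.Algebraic_Closure_Type"
begin

subsection \<open>Normal cone\<close>

abbreviation ideal_power :: "('a, 'm) ring_scheme \<Rightarrow> 'a set \<Rightarrow> nat \<Rightarrow> 'a set" where
  "ideal_power A I d \<equiv> I [^]\<^bsub>ideals_set A\<^esub> d"

text \<open>
  The associated graded ring, the direct sum of all \<open>I^d / I^(d+1)\<close>, where \<open>I^0 = A\<close>.
  An element is the family of its homogeneous components, the one of degree \<open>d\<close> being a coset
  \<open>a + I^(d+1)\<close> with \<open>a \<in> I^d\<close>. Multiplication is convolution: the product of the classes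
  \<open>a + I^(i+1)\<close> and \<open>b + I^(j+1)\<close> is \<open>a b + I^(i+j+1)\<close>, and the products with \<open>i + j = d\<close>
  are added in \<open>A / I^(d+1)\<close>.
\<close>

definition normal_cone_ring :: "('a, 'm) ring_scheme \<Rightarrow> 'a set \<Rightarrow> (nat \<Rightarrow> 'a set) ring" where
  "normal_cone_ring A I = \<lparr>
     carrier = {f. (\<forall>d. \<exists>a \<in> ideal_power A I d. f d = ideal_power A I (Suc d) +>\<^bsub>A\<^esub> a) \<and>
                   finite {d. f d \<noteq> ideal_power A I (Suc d)}},
     monoid.mult = (\<lambda>f g d. \<Oplus>\<^bsub>A Quot ideal_power A I (Suc d)\<^esub> i \<in> {..d}.
                       rcoset_mult A (ideal_power A I (Suc d)) (f i) (g (d - i))),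
     one = (\<lambda>d. if d = 0 then ideal_power A I (Suc 0) +>\<^bsub>A\<^esub> \<one>\<^bsub>A\<^esub> else ideal_power A I (Suc d)),
     zero = (\<lambda>d. ideal_power A I (Suc d)),
     add = (\<lambda>f g d. f d <+>\<^bsub>A\<^esub> g d)\<rparr>"


subsection \<open>Prime spectrum\<close>

definition spec :: "('a, 'm) ring_scheme \<Rightarrow> 'a set set" where
  "spec R = {P. primeideal P R}"

text \<open>The open sets are the complements of the sets \<open>V(S) = {P \<in> spec R. S \<subseteq> P}\<close>.\<close>

definition zariski_open :: "('a, 'm) ring_scheme \<Rightarrow> 'a set set \<Rightarrow> bool" where
  "zariski_open R U \<longleftrightarrow> (\<exists>S \<subseteq> carrier R. U = {P \<in> spec R. \<not> S \<subseteq> P})"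

lemma istopology_zariski_open: "istopology (zariski_open R)"
  unfolding istopology_def
proof (intro conjI allI impI)
  fix U V assume "zariski_open R U" "zariski_open R V"
  then obtain S T where S: "S \<subseteq> carrier R" "U = {P \<in> spec R. \<not> S \<subseteq> P}"
    and T: "T \<subseteq> carrier R" "V = {P \<in> spec R. \<not> T \<subseteq> P}"
    unfolding zariski_open_def by auto
  let ?W = "{s \<otimes>\<^bsub>R\<^esub> t | s t. s \<in> S \<and> t \<in> T} \<inter> carrier R"
  have "(\<not> ?W \<subseteq> P) = (\<not> S \<subseteq> P \<and> \<not> T \<subseteq> P)" if "P \<in> spec R" for P
  proof -
    interpret P: primeideal P R using that by (simp add: spec_def)
    have "s \<otimes>\<^bsub>R\<^esub> t \<in> P \<longleftrightarrow> s \<in> P \<or> t \<in> P" if "s \<in> S" "t \<in> T" for s t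
      using that S(1) T(1) P.I_prime P.I_l_closed P.I_r_closed by blast
    moreover have "s \<otimes>\<^bsub>R\<^esub> t \<in> carrier R" if "s \<in> S" "t \<in> T" for s t
      using that S(1) T(1) by auto
    ultimately show ?thesis by blast
  qed
  then have "U \<inter> V = {P \<in> spec R. \<not> ?W \<subseteq> P}" using S T by blast
  then show "zariski_open R (U \<inter> V)" unfolding zariski_open_def by blast
next
  fix \<K> assume "\<forall>K \<in> \<K>. zariski_open R K"
  then have "\<forall>K \<in> \<K>. \<exists>S. S \<subseteq> carrier R \<and> K = {P \<in> spec R. \<not> S \<subseteq> P}"
    unfolding zariski_open_def by blast
  then obtain S where S: "\<forall>K \<in> \<K>. S K \<subseteq> carrier R \<and> K = {P \<in> spec R. \<not> S K \<subseteq> P}"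
    by metis
  have S1: "S K \<subseteq> carrier R" if "K \<in> \<K>" for K
    using S that by simp
  have S2: "P \<in> K \<longleftrightarrow> P \<in> spec R \<and> \<not> S K \<subseteq> P" if "K \<in> \<K>" for K P
    using arg_cong[OF conjunct2[OF bspec[OF S that]], of "\<lambda>A. P \<in> A"] by simp
  have "\<Union>\<K> = {P \<in> spec R. \<not> (\<Union>K\<in>\<K>. S K) \<subseteq> P}"
  proof (intro Set.set_eqI)
    fix P
    have "P \<in> \<Union>\<K> \<longleftrightarrow> (\<exists>K\<in>\<K>. P \<in> K)" by (rule Union_iff)
    also have "\<dots> \<longleftrightarrow> (\<exists>K\<in>\<K>. P \<in> spec R \<and> \<not> S K \<subseteq> P)"
      by (rule bex_cong[OF refl S2])
    also have "\<dots> \<longleftrightarrow> P \<in> {P \<in> spec R. \<not> (\<Union>K\<in>\<K>. S K) \<subseteq> P}"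
      unfolding mem_Collect_eq UN_subset_iff by blast
    finally show "P \<in> \<Union>\<K> \<longleftrightarrow> P \<in> {P \<in> spec R. \<not> (\<Union>K\<in>\<K>. S K) \<subseteq> P}" .
  qed
  moreover have "(\<Union>K\<in>\<K>. S K) \<subseteq> carrier R"
    using S1 by (simp add: UN_subset_iff)
  ultimately show "zariski_open R (\<Union>\<K>)" unfolding zariski_open_def by blast
qed

definition zariski_topology :: "('a, 'm) ring_scheme \<Rightarrow> 'a set topology" where
  "zariski_topology R = topology (zariski_open R)"

lemma openin_zariski_topology: "openin (zariski_topology R) = zariski_open R"
  unfolding zariski_topology_def by (rule topology_inverse'[OF istopology_zariski_open])

definition irreducible_in :: "'a topology \<Rightarrow> 'a set \<Rightarrow> bool" where
  "irreducible_in T Z \<longleftrightarrow> Z \<subseteq> topspace T \<and> Z \<noteq> {} \<and>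
     (\<forall>F G. closedin T F \<longrightarrow> closedin T G \<longrightarrow> Z \<subseteq> F \<union> G \<longrightarrow> Z \<subseteq> F \<or> Z \<subseteq> G)"

definition irreducible_components :: "'a topology \<Rightarrow> 'a set set" where
  "irreducible_components T =
     {Z. irreducible_in T Z \<and> (\<forall>Z'. irreducible_in T Z' \<longrightarrow> Z \<subseteq> Z' \<longrightarrow> Z' = Z)}"

definition generic_point :: "('a, 'm) ring_scheme \<Rightarrow> 'a set set \<Rightarrow> 'a set" where
  "generic_point R Z =
     (THE P. P \<in> spec R \<and> Abstract_Topology.closure_of (zariski_topology R) {P} = Z)"


subsection \<open>Localisation at a prime ideal\<close>

definition fraction_rel :: "('a, 'm) ring_scheme \<Rightarrow> 'a set \<Rightarrow> (('a \<times> 'a) \<times> ('a \<times> 'a)) set" where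
  "fraction_rel R P = {((a, s), (b, t)).
     a \<in> carrier R \<and> s \<in> carrier R - P \<and> b \<in> carrier R \<and> t \<in> carrier R - P \<and>
     (\<exists>u \<in> carrier R - P. u \<otimes>\<^bsub>R\<^esub> (a \<otimes>\<^bsub>R\<^esub> t) = u \<otimes>\<^bsub>R\<^esub> (b \<otimes>\<^bsub>R\<^esub> s))}"

definition fraction :: "('a, 'm) ring_scheme \<Rightarrow> 'a set \<Rightarrow> 'a \<Rightarrow> 'a \<Rightarrow> ('a \<times> 'a) set" where
  "fraction R P a s = fraction_rel R P `` {(a, s)}"

text \<open>
  The operations are given on representatives; the unions below are unions of a single class,
  as in \<open>HOL.Equiv_Relations\<close>.
\<close>

definition local_ring_at :: "('a, 'm) ring_scheme \<Rightarrow> 'a set \<Rightarrow> ('a \<times> 'a) set ring" where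
  "local_ring_at R P = \<lparr>
     carrier = (carrier R \<times> (carrier R - P)) // fraction_rel R P,
     monoid.mult = (\<lambda>p q. \<Union>(a, s) \<in> p. \<Union>(b, t) \<in> q. fraction R P (a \<otimes>\<^bsub>R\<^esub> b) (s \<otimes>\<^bsub>R\<^esub> t)),
     one = fraction R P \<one>\<^bsub>R\<^esub> \<one>\<^bsub>R\<^esub>,
     zero = fraction R P \<zero>\<^bsub>R\<^esub> \<one>\<^bsub>R\<^esub>,
     add = (\<lambda>p q. \<Union>(a, s) \<in> p. \<Union>(b, t) \<in> q.
              fraction R P ((a \<otimes>\<^bsub>R\<^esub> t) \<oplus>\<^bsub>R\<^esub> (b \<otimes>\<^bsub>R\<^esub> s)) (s \<otimes>\<^bsub>R\<^esub> t))\<rparr>"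


subsection \<open>Length\<close>

definition module_length :: "('r, 'm) ring_scheme \<Rightarrow> ('r, 'b, 'n) module_scheme \<Rightarrow> enat" where
  "module_length R M =
     Sup {enat n | n. \<exists>N. (\<forall>i\<le>n. submodule (N i) R M) \<and> (\<forall>i<n. N i \<subset> N (Suc i))}"

definition self_module :: "('r, 'm) ring_scheme \<Rightarrow> ('r, 'r) module" where
  "self_module R = \<lparr>carrier = carrier R, monoid.mult = monoid.mult R, one = one R,
     zero = zero R, add = add R, module.smult = monoid.mult R\<rparr>"

definition ring_length :: "('r, 'm) ring_scheme \<Rightarrow> enat" where
  "ring_length R = module_length R (self_module R)"


subsection \<open>Behrend number\<close>

text \<open>
  For \<open>A\<close> a polynomial ring over the complex numbers and \<open>I\<close> the ideal of a fat point in
  \<open>Spec A\<close>, this is the Behrend number of \<open>A / I\<close>, computed with the given embedding. The normal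
  cone is then Noetherian, so the sum has finitely many terms.
\<close>

definition behrend_number :: "('a, 'm) ring_scheme \<Rightarrow> 'a set \<Rightarrow> enat" where
  "behrend_number A I =
     (let C = normal_cone_ring A I
      in \<Sum>D \<in> irreducible_components (zariski_topology C).
           ring_length (local_ring_at C (generic_point C D)))"


subsection \<open>Monomial ideals in two variables\<close>

text \<open>\<open>\<complex>[x, y]\<close> is realised as \<open>\<complex>[x][y]\<close>.\<close>

abbreviation Cxy :: "complex poly poly ring" where
  "Cxy \<equiv> ring_of_type_algebra"

definition var_x :: "complex poly poly" where
  "var_x = [:[:0, 1:]:]"

definition var_y :: "complex poly poly" where
  "var_y = [:0, 1:]"

definition normalisation :: "complex poly poly set \<Rightarrow> complex poly poly set" where
  "normalisation I =
     Idl\<^bsub>Cxy\<^esub> {var_x ^ a * var_y ^ b | a b.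
               \<exists>p\<ge>1. (var_x ^ a * var_y ^ b) ^ p \<in> ideal_power Cxy I p}"

definition normal_ideal :: "nat \<Rightarrow> nat \<Rightarrow> complex poly poly set" where
  "normal_ideal \<alpha> \<beta> = normalisation (Idl\<^bsub>Cxy\<^esub> {var_x ^ \<alpha>, var_y ^ \<beta>})"

end

theory Submission
  imports Defs
begin

text \<open>
  Write \<open>\<alpha> = g q\<close> and \<open>\<beta> = g p\<close> with \<open>g = gcd \<alpha> \<beta>\<close>, and let \<open>v\<close> be the order on \<open>\<complex>[x, y]\<close> that gives \<open>x\<close>
  the weight \<open>p\<close> and \<open>y\<close> the weight \<open>q\<close>. Put \<open>L = g p q\<close>, the number to be computed. The
  normalisation \<open>I\<close> of \<open>(x^\<alpha>, y^\<beta>)\<close> is \<open>{v \<ge> L}\<close> (\<open>normal_ideal_eq\<close>), and its powers are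
  \<open>I^d = {v \<ge> d L}\<close> (\<open>ideal_power_weight\<close>).

  The normal cone is a quotient of the Rees ring, the polynomials in a further variable \<open>T\<close> whose
  coefficient at \<open>T^d\<close> lies in \<open>I^d\<close>. Extend \<open>v\<close> to a valuation \<open>V\<close> of \<open>\<complex>[x, y, T]\<close> by giving \<open>T\<close> the
  value \<open>- L\<close>. Then the Rees ring is \<open>{V \<ge> 0}\<close> and the normal cone is its quotient by \<open>{V \<ge> L}\<close>
  (\<open>normal_cone_generically_uniserial\<close>). So the cone carries a truncated valuation \<open>\<omega>\<close> with
  values in \<open>{0..L}\<close>.

  The elements with \<open>\<omega> > 0\<close> form a prime ideal, and their \<open>L\<close>-th powers vanish. Hence this is the least
  prime and the cone is irreducible (\<open>irreducible_spec_if_least_prime\<close>). Since \<open>p\<close> and \<open>q\<close> are coprime, \<open>V\<close>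
  takes every integer value, and a common factor of suitable value turns any quotient of
  elements with nonnegative difference of values into a fraction whose denominator has value \<open>0\<close>. So at the
  generic point divisibility is decided by \<open>\<omega>\<close>: the local ring looks like a discrete valuation
  ring modulo the \<open>L\<close>-th power of its maximal ideal. Its ideals are the \<open>L + 1\<close> sets
  \<open>{\<omega> \<ge> k}\<close>, and its length is \<open>L\<close> (\<open>ring_length_eq\<close>, \<open>ring_length_local_ring_at\<close>).
\<close>

section \<open>Localisation at a prime ideal\<close>

context primeideal
begin

lemma outside_mult_closed:
  "s \<in> carrier R - I \<Longrightarrow> t \<in> carrier R - I \<Longrightarrow> s \<otimes> t \<in> carrier R - I"
  using I_prime by blast

lemma one_outside: "\<one> \<in> carrier R - I"
  using I_notcarr one_imp_carrier by blast

lemma equiv_fraction_rel: "equiv (carrier R \<times> (carrier R - I)) (fraction_rel R I)"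
proof (rule equivI)
  show "fraction_rel R I \<subseteq> (carrier R \<times> (carrier R - I)) \<times> (carrier R \<times> (carrier R - I))"
    by (auto simp: fraction_rel_def)
  show "refl_on (carrier R \<times> (carrier R - I)) (fraction_rel R I)"
    using one_outside by (auto simp: fraction_rel_def refl_on_def)
  show "sym (fraction_rel R I)"
    unfolding fraction_rel_def sym_def by auto (metis DiffI)
  show "trans (fraction_rel R I)"
  proof (rule transI, clarsimp simp: fraction_rel_def)
    fix a s b t c w u v
    assume [simp]: "a \<in> carrier R" "s \<in> carrier R" "b \<in> carrier R" "t \<in> carrier R"
        "c \<in> carrier R" "w \<in> carrier R" "u \<in> carrier R" "v \<in> carrier R"
      and out: "s \<notin> I" "t \<notin> I" "w \<notin> I" "u \<notin> I" "v \<notin> I"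
      and e1: "u \<otimes> (a \<otimes> t) = u \<otimes> (b \<otimes> s)" and e2: "v \<otimes> (b \<otimes> w) = v \<otimes> (c \<otimes> t)"
    have "(u \<otimes> v \<otimes> t) \<otimes> (a \<otimes> w) = (v \<otimes> w) \<otimes> (u \<otimes> (a \<otimes> t))" by (simp add: m_ac)
    also have "\<dots> = (u \<otimes> s) \<otimes> (v \<otimes> (b \<otimes> w))" unfolding e1 by (simp add: m_ac)
    also have "\<dots> = (u \<otimes> v \<otimes> t) \<otimes> (c \<otimes> s)" unfolding e2 by (simp add: m_ac)
    finally show "\<exists>u\<in>carrier R - I. u \<otimes> (a \<otimes> w) = u \<otimes> (c \<otimes> s)"
      using outside_mult_closed out by (intro bexI[of _ "u \<otimes> v \<otimes> t"]) auto
  qed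
qed

lemma fraction_eq_iff:
  assumes "a \<in> carrier R" "b \<in> carrier R" "s \<in> carrier R - I" "t \<in> carrier R - I"
  shows "fraction R I a s = fraction R I b t \<longleftrightarrow>
    (\<exists>u \<in> carrier R - I. u \<otimes> (a \<otimes> t) = u \<otimes> (b \<otimes> s))"
proof -
  have "fraction R I a s = fraction R I b t \<longleftrightarrow> ((a, s), (b, t)) \<in> fraction_rel R I"
    unfolding fraction_def using assms by (intro eq_equiv_class_iff[OF equiv_fraction_rel]) auto
  then show ?thesis using assms by (simp add: fraction_rel_def)
qed

lemma mem_fraction:
  assumes "a \<in> carrier R" "s \<in> carrier R - I"
  shows "(a, s) \<in> fraction R I a s"
  unfolding fraction_def using assms by (intro equiv_class_self[OF equiv_fraction_rel]) auto

lemma mem_fractionD: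
  assumes "(b, t) \<in> fraction R I a s"
  shows "a \<in> carrier R" "s \<in> carrier R - I" "b \<in> carrier R" "t \<in> carrier R - I"
    and "\<exists>u \<in> carrier R - I. u \<otimes> (a \<otimes> t) = u \<otimes> (b \<otimes> s)"
  using assms by (auto simp: fraction_def fraction_rel_def)

lemma fraction_closed:
  "a \<in> carrier R \<Longrightarrow> s \<in> carrier R - I \<Longrightarrow> fraction R I a s \<in> carrier (local_ring_at R I)"
  by (auto simp: local_ring_at_def fraction_def intro!: quotientI)

lemma fraction_cases:
  assumes "p \<in> carrier (local_ring_at R I)"
  obtains a s where "a \<in> carrier R" "s \<in> carrier R - I" "p = fraction R I a s"
  using assms by (auto simp: local_ring_at_def fraction_def elim!: quotientE)

text \<open>
  The operations of the local ring are unions over all representatives of the operands. This rule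
  reduces each of them to the independence of the representatives.
\<close>

lemma UN_fractions:
  assumes "a \<in> carrier R" "s \<in> carrier R - I" "b \<in> carrier R" "t \<in> carrier R - I"
    and "\<And>a' s' b' t'. (a', s') \<in> fraction R I a s \<Longrightarrow> (b', t') \<in> fraction R I b t \<Longrightarrow>
      F a' s' b' t' = F a s b t"
  shows "(\<Union>(a', s') \<in> fraction R I a s. \<Union>(b', t') \<in> fraction R I b t. F a' s' b' t') = F a s b t"
proof -
  have "(\<Union>x \<in> fraction R I a s. \<Union>y \<in> fraction R I b t. case_prod (case_prod F x) y) = F a s b t"
    using mem_fraction[OF assms(1,2)] mem_fraction[OF assms(3,4)] assms(5) by fast
  then show ?thesis by (simp add: case_prod_unfold)
qed

lemma mult_fraction:
  assumes "a \<in> carrier R" "s \<in> carrier R - I" "b \<in> carrier R" "t \<in> carrier R - I"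
  shows "fraction R I a s \<otimes>\<^bsub>local_ring_at R I\<^esub> fraction R I b t = fraction R I (a \<otimes> b) (s \<otimes> t)"
proof -
  have "fraction R I (a' \<otimes> b') (s' \<otimes> t') = fraction R I (a \<otimes> b) (s \<otimes> t)"
    if A: "(a', s') \<in> fraction R I a s" and B: "(b', t') \<in> fraction R I b t" for a' s' b' t'
  proof -
    note a = mem_fractionD[OF A] and b = mem_fractionD[OF B]
    obtain u v where u: "u \<in> carrier R - I" "u \<otimes> (a \<otimes> s') = u \<otimes> (a' \<otimes> s)"
      and v: "v \<in> carrier R - I" "v \<otimes> (b \<otimes> t') = v \<otimes> (b' \<otimes> t)" using a(5) b(5) by blast
    have [simp]: "s' \<in> carrier R" "t' \<in> carrier R" "s \<in> carrier R" "t \<in> carrier R"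
      "u \<in> carrier R" "v \<in> carrier R" using a b u(1) v(1) by auto
    note [simp] = assms(1,3) a(3) b(3)
    have "(u \<otimes> v) \<otimes> ((a' \<otimes> b') \<otimes> (s \<otimes> t)) = (u \<otimes> (a' \<otimes> s)) \<otimes> (v \<otimes> (b' \<otimes> t))"
      by (simp add: m_ac)
    also have "\<dots> = (u \<otimes> v) \<otimes> ((a \<otimes> b) \<otimes> (s' \<otimes> t'))"
      unfolding u(2)[symmetric] v(2)[symmetric] by (simp add: m_ac)
    finally show ?thesis
      using a b assms outside_mult_closed[OF u(1) v(1)] outside_mult_closed
      by (subst fraction_eq_iff) blast+
  qed
  then have "(\<Union>(a', s') \<in> fraction R I a s. \<Union>(b', t') \<in> fraction R I b t.
      fraction R I (a' \<otimes> b') (s' \<otimes> t')) = fraction R I (a \<otimes> b) (s \<otimes> t)"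
    by (intro UN_fractions[OF assms])
  then show ?thesis by (simp add: local_ring_at_def)
qed

lemma add_fraction:
  assumes "a \<in> carrier R" "s \<in> carrier R - I" "b \<in> carrier R" "t \<in> carrier R - I"
  shows "fraction R I a s \<oplus>\<^bsub>local_ring_at R I\<^esub> fraction R I b t =
    fraction R I ((a \<otimes> t) \<oplus> (b \<otimes> s)) (s \<otimes> t)"
proof -
  have "fraction R I ((a' \<otimes> t') \<oplus> (b' \<otimes> s')) (s' \<otimes> t') = fraction R I ((a \<otimes> t) \<oplus> (b \<otimes> s)) (s \<otimes> t)"
    if A: "(a', s') \<in> fraction R I a s" and B: "(b', t') \<in> fraction R I b t" for a' s' b' t'
  proof -
    note a = mem_fractionD[OF A] and b = mem_fractionD[OF B]
    obtain u v where u: "u \<in> carrier R - I" "u \<otimes> (a \<otimes> s') = u \<otimes> (a' \<otimes> s)"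
      and v: "v \<in> carrier R - I" "v \<otimes> (b \<otimes> t') = v \<otimes> (b' \<otimes> t)" using a(5) b(5) by blast
    have c [simp]: "s' \<in> carrier R" "t' \<in> carrier R" "s \<in> carrier R" "t \<in> carrier R"
      "u \<in> carrier R" "v \<in> carrier R" using a b u(1) v(1) by auto
    note [simp] = assms(1,3) a(3) b(3)
    have "(u \<otimes> v) \<otimes> ((a' \<otimes> t' \<oplus> b' \<otimes> s') \<otimes> (s \<otimes> t)) =
        (u \<otimes> (a' \<otimes> s)) \<otimes> (v \<otimes> t \<otimes> t') \<oplus> (v \<otimes> (b' \<otimes> t)) \<otimes> (u \<otimes> s \<otimes> s')"
      by (simp add: m_ac l_distr r_distr)
    also have "\<dots> = (u \<otimes> v) \<otimes> ((a \<otimes> t \<oplus> b \<otimes> s) \<otimes> (s' \<otimes> t'))"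
      unfolding u(2)[symmetric] v(2)[symmetric] by (simp add: m_ac l_distr r_distr)
    finally show ?thesis
      using a b assms outside_mult_closed[OF u(1) v(1)] outside_mult_closed
      by (subst fraction_eq_iff) (blast intro: a_closed m_closed c)+
  qed
  then have "(\<Union>(a', s') \<in> fraction R I a s. \<Union>(b', t') \<in> fraction R I b t.
      fraction R I ((a' \<otimes> t') \<oplus> (b' \<otimes> s')) (s' \<otimes> t')) = fraction R I ((a \<otimes> t) \<oplus> (b \<otimes> s)) (s \<otimes> t)"
    by (intro UN_fractions[OF assms])
  then show ?thesis by (simp add: local_ring_at_def)
qed

lemma zero_fraction: "\<zero>\<^bsub>local_ring_at R I\<^esub> = fraction R I \<zero> \<one>"
  and one_fraction: "\<one>\<^bsub>local_ring_at R I\<^esub> = fraction R I \<one> \<one>"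
  by (simp_all add: local_ring_at_def)

lemma fraction_eqI:
  assumes "a \<in> carrier R" "b \<in> carrier R" "s \<in> carrier R - I" "t \<in> carrier R - I"
    and "a \<otimes> t = b \<otimes> s"
  shows "fraction R I a s = fraction R I b t"
  using assms one_outside by (subst fraction_eq_iff) auto

lemma cring_local_ring_at: "cring (local_ring_at R I)"
proof (rule cringI)
  note closed = outside_mult_closed one_outside
  show "abelian_group (local_ring_at R I)"
  proof (rule abelian_groupI)
    fix x assume "x \<in> carrier (local_ring_at R I)"
    then obtain a s where x: "a \<in> carrier R" "s \<in> carrier R - I" "x = fraction R I a s"
      by (rule fraction_cases)
    show "\<zero>\<^bsub>local_ring_at R I\<^esub> \<oplus>\<^bsub>local_ring_at R I\<^esub> x = x"
      using x closed by (auto simp: add_fraction zero_fraction)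
    have "fraction R I \<zero> (s \<otimes> s) = fraction R I \<zero> \<one>"
      using x closed by (intro fraction_eqI) auto
    then have "fraction R I (\<ominus> a) s \<oplus>\<^bsub>local_ring_at R I\<^esub> x = \<zero>\<^bsub>local_ring_at R I\<^esub>"
      using x closed by (auto simp: add_fraction zero_fraction l_minus l_neg)
    then show "\<exists>y \<in> carrier (local_ring_at R I). y \<oplus>\<^bsub>local_ring_at R I\<^esub> x = \<zero>\<^bsub>local_ring_at R I\<^esub>"
      using x by (blast intro: fraction_closed)
    fix y assume "y \<in> carrier (local_ring_at R I)"
    then obtain b t where y: "b \<in> carrier R" "t \<in> carrier R - I" "y = fraction R I b t"
      by (rule fraction_cases)
    show "x \<oplus>\<^bsub>local_ring_at R I\<^esub> y \<in> carrier (local_ring_at R I)"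
      using x y closed by (auto simp: add_fraction intro!: fraction_closed)
    show "x \<oplus>\<^bsub>local_ring_at R I\<^esub> y = y \<oplus>\<^bsub>local_ring_at R I\<^esub> x"
      using x y by (auto simp: add_fraction a_comm m_comm)
    fix z assume "z \<in> carrier (local_ring_at R I)"
    then obtain c w where z: "c \<in> carrier R" "w \<in> carrier R - I" "z = fraction R I c w"
      by (rule fraction_cases)
    have "fraction R I ((a \<otimes> t \<oplus> b \<otimes> s) \<otimes> w \<oplus> c \<otimes> (s \<otimes> t)) (s \<otimes> t \<otimes> w)
        = fraction R I (a \<otimes> (t \<otimes> w) \<oplus> (b \<otimes> w \<oplus> c \<otimes> t) \<otimes> s) (s \<otimes> (t \<otimes> w))"
      by (rule arg_cong2[of _ _ _ _ "fraction R I"]) (use x y z in \<open>auto simp: m_ac a_ac l_distr r_distr\<close>)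
    then show "x \<oplus>\<^bsub>local_ring_at R I\<^esub> y \<oplus>\<^bsub>local_ring_at R I\<^esub> z =
        x \<oplus>\<^bsub>local_ring_at R I\<^esub> (y \<oplus>\<^bsub>local_ring_at R I\<^esub> z)"
      using x y z closed by (simp add: add_fraction)
  qed (use one_outside in \<open>auto simp: zero_fraction intro!: fraction_closed\<close>)
  show "comm_monoid (local_ring_at R I)"
  proof (rule comm_monoidI)
    fix x assume "x \<in> carrier (local_ring_at R I)"
    then obtain a s where x: "a \<in> carrier R" "s \<in> carrier R - I" "x = fraction R I a s"
      by (rule fraction_cases)
    show "\<one>\<^bsub>local_ring_at R I\<^esub> \<otimes>\<^bsub>local_ring_at R I\<^esub> x = x"
      using x closed by (auto simp: mult_fraction one_fraction)
    fix y assume "y \<in> carrier (local_ring_at R I)"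
    then obtain b t where y: "b \<in> carrier R" "t \<in> carrier R - I" "y = fraction R I b t"
      by (rule fraction_cases)
    show "x \<otimes>\<^bsub>local_ring_at R I\<^esub> y \<in> carrier (local_ring_at R I)"
      using x y closed by (auto simp: mult_fraction intro!: fraction_closed)
    show "x \<otimes>\<^bsub>local_ring_at R I\<^esub> y = y \<otimes>\<^bsub>local_ring_at R I\<^esub> x"
      using x y by (auto simp: mult_fraction m_comm)
    fix z assume "z \<in> carrier (local_ring_at R I)"
    then obtain c w where z: "c \<in> carrier R" "w \<in> carrier R - I" "z = fraction R I c w"
      by (rule fraction_cases)
    show "x \<otimes>\<^bsub>local_ring_at R I\<^esub> y \<otimes>\<^bsub>local_ring_at R I\<^esub> z =
        x \<otimes>\<^bsub>local_ring_at R I\<^esub> (y \<otimes>\<^bsub>local_ring_at R I\<^esub> z)"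
      using x y z closed by (simp add: mult_fraction m_assoc)
  qed (use one_outside in \<open>auto simp: one_fraction intro!: fraction_closed\<close>)
  fix x y z assume "x \<in> carrier (local_ring_at R I)" "y \<in> carrier (local_ring_at R I)"
    "z \<in> carrier (local_ring_at R I)"
  then obtain a s b t c w where x: "a \<in> carrier R" "s \<in> carrier R - I" "x = fraction R I a s"
    and y: "b \<in> carrier R" "t \<in> carrier R - I" "y = fraction R I b t"
    and z: "c \<in> carrier R" "w \<in> carrier R - I" "z = fraction R I c w"
    by (metis fraction_cases)
  have "fraction R I ((a \<otimes> t \<oplus> b \<otimes> s) \<otimes> c) (s \<otimes> t \<otimes> w) =
      fraction R I ((a \<otimes> c) \<otimes> (t \<otimes> w) \<oplus> (b \<otimes> c) \<otimes> (s \<otimes> w)) ((s \<otimes> w) \<otimes> (t \<otimes> w))"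
    using x y z closed by (intro fraction_eqI) (auto simp: m_ac l_distr r_distr)
  then show "(x \<oplus>\<^bsub>local_ring_at R I\<^esub> y) \<otimes>\<^bsub>local_ring_at R I\<^esub> z =
      x \<otimes>\<^bsub>local_ring_at R I\<^esub> z \<oplus>\<^bsub>local_ring_at R I\<^esub> y \<otimes>\<^bsub>local_ring_at R I\<^esub> z"
    using x y z closed by (simp add: mult_fraction add_fraction)
qed

end


section \<open>Truncated valuations\<close>

text \<open>
  The model is the quotient of a valuation ring by the elements of value at least \<open>L\<close>: all of these
  become zero, so values are cut off at \<open>L\<close>. Divisibility is left out, since in the normal cone it
  is governed by the value only after localisation.
\<close>

locale truncated_valuation = cring R for R (structure) +
  fixes \<omega> :: "'a \<Rightarrow> nat" and L :: nat
  assumes L_pos: "0 < L"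
    and value_le: "a \<in> carrier R \<Longrightarrow> \<omega> a \<le> L"
    and value_eq_L_iff: "a \<in> carrier R \<Longrightarrow> \<omega> a = L \<longleftrightarrow> a = \<zero>"
    and value_add: "a \<in> carrier R \<Longrightarrow> b \<in> carrier R \<Longrightarrow> min (\<omega> a) (\<omega> b) \<le> \<omega> (a \<oplus> b)"
    and value_mult: "a \<in> carrier R \<Longrightarrow> b \<in> carrier R \<Longrightarrow> \<omega> (a \<otimes> b) = min L (\<omega> a + \<omega> b)"
    and value_surj: "k \<le> L \<Longrightarrow> \<exists>a \<in> carrier R. \<omega> a = k"
begin

lemma value_zero: "\<omega> \<zero> = L"
  by (simp add: value_eq_L_iff)

lemma value_one: "\<omega> \<one> = 0"
proof -
  obtain a where "a \<in> carrier R" "\<omega> a = 0" using value_surj[of 0] by auto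
  then show ?thesis using value_mult[of \<one> a] value_le[of \<one>] by simp
qed

lemma value_uminus: "a \<in> carrier R \<Longrightarrow> \<omega> (\<ominus> a) = \<omega> a"
proof -
  have *: "\<omega> a \<le> \<omega> (\<ominus> a)" if "a \<in> carrier R" for a
  proof -
    have "\<omega> (\<ominus> a) = \<omega> (\<ominus> \<one> \<otimes> a)" using that by (simp add: l_minus)
    then show ?thesis using that value_mult[of "\<ominus> \<one>" a] value_le[of a] by simp
  qed
  assume "a \<in> carrier R"
  then show ?thesis using *[of a] *[of "\<ominus> a"] by simp
qed

text \<open>
  If divisibility is decided by the value, an ideal is determined by the least value it attains,
  so the ideals form a chain with exactly \<open>L + 1\<close> members.
\<close>

lemma ring_length_eq:
  assumes div: "\<And>a b. a \<in> carrier R \<Longrightarrow> b \<in> carrier R \<Longrightarrow> \<omega> b \<le> \<omega> a \<Longrightarrow>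
    \<exists>t \<in> carrier R. a = t \<otimes> b"
  shows "ring_length R = enat L"
proof -
  let ?M = "self_module R"
  have M: "carrier ?M = carrier R" "\<zero>\<^bsub>?M\<^esub> = \<zero>" "add ?M = add R" "module.smult ?M = monoid.mult R"
    by (simp_all add: self_module_def)
  have inv: "\<ominus>\<^bsub>?M\<^esub> a = \<ominus> a" for a
    by (simp add: a_inv_def m_inv_def self_module_def)
  have "abelian_group ?M"
    by (rule abelian_groupI) (auto simp: M a_ac intro: l_neg)
  then interpret M: module R ?M
    by (intro moduleI is_cring) (auto simp: M l_distr r_distr m_assoc)
  define V where "V k = {a \<in> carrier R. k \<le> \<omega> a}" for k
  have V_sub: "submodule (V k) R ?M" if "k \<le> L" for k
  proof (rule M.submoduleI)
    fix a b assume "a \<in> V k" "b \<in> V k"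
    then show "a \<oplus>\<^bsub>?M\<^esub> b \<in> V k" using value_add[of a b] by (auto simp: V_def M)
  next
    fix a x assume "a \<in> carrier R" "x \<in> V k"
    then show "a \<odot>\<^bsub>?M\<^esub> x \<in> V k" using that by (auto simp: V_def M value_mult)
  qed (use that in \<open>auto simp: V_def M inv value_zero value_uminus\<close>)
  have V_strict: "V (Suc k) \<subset> V k" if "Suc k \<le> L" for k
  proof -
    obtain a where "a \<in> carrier R" "\<omega> a = k"
      using value_surj[of k] \<open>Suc k \<le> L\<close> Suc_leD by blast
    then have "a \<in> V k - V (Suc k)" by (simp add: V_def)
    moreover have "V (Suc k) \<subseteq> V k" by (auto simp: V_def)
    ultimately show ?thesis by blast
  qed
  have sub_V: "\<exists>k \<le> L. N = V k" if N: "submodule N R ?M" for N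
  proof -
    have *: "N \<subseteq> carrier R" "\<zero> \<in> N" "\<And>a x. a \<in> carrier R \<Longrightarrow> x \<in> N \<Longrightarrow> a \<otimes> x \<in> N"
      using M.submoduleE[OF N] subgroup.one_closed[OF submodule.axioms(1)[OF N]] by (auto simp: M)
    obtain b where b: "b \<in> N" "\<And>a. a \<in> N \<Longrightarrow> \<omega> b \<le> \<omega> a"
      using ex_has_least_nat[of "\<lambda>a. a \<in> N" \<zero> \<omega>] *(2) by blast
    have "N = V (\<omega> b)"
    proof
      show "N \<subseteq> V (\<omega> b)" using b * by (auto simp: V_def)
      show "V (\<omega> b) \<subseteq> N"
      proof
        fix a assume a: "a \<in> V (\<omega> b)"
        then obtain t where "t \<in> carrier R" "a = t \<otimes> b" using div[of a b] b(1) *(1) by (auto simp: V_def)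
        then show "a \<in> N" using * b(1) by blast
      qed
    qed
    then show ?thesis using value_le b(1) *(1) by blast
  qed
  have "n \<le> L" if sub: "\<forall>i\<le>n. submodule (N i) R ?M" and strict: "\<forall>i<n. N i \<subset> N (Suc i)" for N n
  proof -
    have "\<forall>i\<le>n. \<exists>k \<le> L. N i = V k" using sub sub_V by blast
    then obtain m where m: "\<And>i. i \<le> n \<Longrightarrow> m i \<le> L \<and> N i = V (m i)" by metis
    have "m i + i \<le> L" if "i \<le> n" for i
      using that
    proof (induction i)
      case 0 then show ?case using m by simp
    next
      case (Suc i)
      then have "V (m i) \<subset> V (m (Suc i))" using strict[rule_format, of i] m[of i] m[of "Suc i"] by simp
      then have "\<not> m i \<le> m (Suc i)" by (auto simp: V_def)
      with Suc show ?case by simp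
    qed
    from this[of n] show ?thesis by simp
  qed
  moreover have "\<exists>N. (\<forall>i\<le>L. submodule (N i) R ?M) \<and> (\<forall>i<L. N i \<subset> N (Suc i))"
  proof (intro exI[of _ "\<lambda>i. V (L - i)"] conjI allI impI)
    fix i assume "i < L"
    then show "V (L - i) \<subset> V (L - Suc i)" using V_strict[of "L - Suc i"] by (simp add: Suc_diff_Suc)
  qed (simp add: V_sub)
  ultimately show ?thesis
    unfolding ring_length_def module_length_def
    by (intro antisym Sup_least Sup_upper) (clarsimp, blast)
qed

text \<open>
  A product of elements of value \<open>0\<close> has value \<open>0\<close>, so the elements of positive value form a prime
  ideal. By the next lemma it is the least one.
\<close>

lemma primeideal_positive: "primeideal {a \<in> carrier R. 0 < \<omega> a} R"
proof (rule primeidealI)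
  show "ideal {a \<in> carrier R. 0 < \<omega> a} R"
  proof (rule idealI)
    show "ring R" by (rule ring_axioms)
    show "subgroup {a \<in> carrier R. 0 < \<omega> a} (add_monoid R)"
    proof (rule add.subgroupI)
      fix a b assume "a \<in> {a \<in> carrier R. 0 < \<omega> a}" "b \<in> {a \<in> carrier R. 0 < \<omega> a}"
      then show "a \<oplus> b \<in> {a \<in> carrier R. 0 < \<omega> a}" using value_add[of a b] by auto
    next
      fix a assume "a \<in> {a \<in> carrier R. 0 < \<omega> a}"
      then show "\<ominus> a \<in> {a \<in> carrier R. 0 < \<omega> a}"
        using value_uminus[of a] by auto
    next
      show "{a \<in> carrier R. 0 < \<omega> a} \<noteq> {}" using value_zero L_pos zero_closed by fastforce
    qed auto
  qed (use L_pos in \<open>auto simp: value_mult\<close>)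
  show "cring R" by (rule is_cring)
  show "carrier R \<noteq> {a \<in> carrier R. 0 < \<omega> a}"
  proof
    assume "carrier R = {a \<in> carrier R. 0 < \<omega> a}"
    from equalityD1[OF this] have "\<one> \<in> {a \<in> carrier R. 0 < \<omega> a}" using one_closed by (rule subsetD)
    then show False by (simp add: value_one)
  qed
  show "a \<in> {a \<in> carrier R. 0 < \<omega> a} \<or> b \<in> {a \<in> carrier R. 0 < \<omega> a}"
    if "a \<in> carrier R" "b \<in> carrier R" "a \<otimes> b \<in> {a \<in> carrier R. 0 < \<omega> a}" for a b
    using that by (auto simp: value_mult)
qed

text \<open>The \<open>L\<close>-th power of an element of positive value has value \<open>L\<close>, so it vanishes.\<close>

lemma positive_subset_prime:
  assumes "primeideal Q R"
  shows "{a \<in> carrier R. 0 < \<omega> a} \<subseteq> Q"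
proof
  interpret Q: primeideal Q R by fact
  fix a assume a: "a \<in> {a \<in> carrier R. 0 < \<omega> a}"
  have "min L n \<le> \<omega> (a [^] n)" for n :: nat
    by (induction n) (use a in \<open>auto simp: value_mult\<close>)
  from this[of L] have "\<omega> (a [^] L) = L" using value_le[of "a [^] L"] a by auto
  then have "a [^] L \<in> Q" using a value_eq_L_iff[of "a [^] L"] by simp
  moreover have "a [^] n \<in> Q \<Longrightarrow> a \<in> Q" for n :: nat
  proof (induction n)
    case 0 then show ?case using Q.one_outside by simp
  next
    case (Suc n) then show ?case using Q.I_prime[of "a [^] n" a] a by auto
  qed
  ultimately show "a \<in> Q" by blast
qed

end

section \<open>Spectra with a least prime\<close>

lemma topspace_zariski_topology: "topspace (zariski_topology R) = spec R"
proof -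
  have "\<not> carrier R \<subseteq> P" if "P \<in> spec R" for P
  proof -
    interpret primeideal P R using that by (simp add: spec_def)
    show ?thesis using one_outside by blast
  qed
  then have "zariski_open R (spec R)" unfolding zariski_open_def by blast
  moreover have "U \<subseteq> spec R" if "zariski_open R U" for U
    using that unfolding zariski_open_def by blast
  ultimately show ?thesis
    unfolding topspace_def openin_zariski_topology by blast
qed

lemma closedin_zariski_topology_iff:
  "closedin (zariski_topology R) F \<longleftrightarrow> (\<exists>S \<subseteq> carrier R. F = {P \<in> spec R. S \<subseteq> P})"
proof -
  have *: "F \<subseteq> spec R \<and> spec R - F = {P \<in> spec R. \<not> S \<subseteq> P} \<longleftrightarrow> F = {P \<in> spec R. S \<subseteq> P}" for S
    by auto
  have "closedin (zariski_topology R) F \<longleftrightarrow>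
      (\<exists>S. S \<subseteq> carrier R \<and> (F \<subseteq> spec R \<and> spec R - F = {P \<in> spec R. \<not> S \<subseteq> P}))"
    unfolding closedin_def topspace_zariski_topology openin_zariski_topology zariski_open_def
    by (intro iffI; elim exE conjE; intro exI conjI; assumption)
  then show ?thesis by (simp only: *)
qed

lemma zariski_closure_of_point:
  assumes "P \<in> spec R"
  shows "zariski_topology R closure_of {P} = {Q \<in> spec R. P \<subseteq> Q}"
proof (rule closure_of_unique)
  interpret primeideal P R using assms by (simp add: spec_def)
  show "{P} \<subseteq> {Q \<in> spec R. P \<subseteq> Q}" using assms by simp
  show "closedin (zariski_topology R) {Q \<in> spec R. P \<subseteq> Q}"
    unfolding closedin_zariski_topology_iff using Icarr by (intro exI[of _ P]) auto
  show "{Q \<in> spec R. P \<subseteq> Q} \<subseteq> F" if "{P} \<subseteq> F" "closedin (zariski_topology R) F" for F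
  proof -
    obtain S where S: "F = {Q \<in> spec R. S \<subseteq> Q}"
      using \<open>closedin (zariski_topology R) F\<close> unfolding closedin_zariski_topology_iff by blast
    with \<open>{P} \<subseteq> F\<close> have "S \<subseteq> P" by simp
    with S show ?thesis by auto
  qed
qed

text \<open>A closed set that contains the least prime contains every prime.\<close>

lemma irreducible_spec_if_least_prime:
  assumes "P \<in> spec R" and "\<And>Q. Q \<in> spec R \<Longrightarrow> P \<subseteq> Q"
  shows "irreducible_components (zariski_topology R) = {spec R}"
    and "generic_point R (spec R) = P"
proof -
  have *: "F = spec R" if "closedin (zariski_topology R) F" "P \<in> F" for F
    using that assms(2) unfolding closedin_zariski_topology_iff by blast
  have "irreducible_in (zariski_topology R) (spec R)"
    unfolding irreducible_in_def topspace_zariski_topology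
  proof (intro conjI allI impI)
    fix F G
    assume "closedin (zariski_topology R) F" "closedin (zariski_topology R) G" "spec R \<subseteq> F \<union> G"
    then have "F = spec R \<or> G = spec R" using *[of F] *[of G] subsetD[OF _ assms(1), of "F \<union> G"] by auto
    then show "spec R \<subseteq> F \<or> spec R \<subseteq> G" by auto
  qed (use assms(1) in auto)
  moreover have "Z \<subseteq> spec R" if "irreducible_in (zariski_topology R) Z" for Z
    using that by (simp add: irreducible_in_def topspace_zariski_topology)
  ultimately have "irreducible_in (zariski_topology R) Z \<and>
      (\<forall>Z'. irreducible_in (zariski_topology R) Z' \<longrightarrow> Z \<subseteq> Z' \<longrightarrow> Z' = Z) \<longleftrightarrow> Z = spec R" for Z
    by (metis subset_antisym)
  then show "irreducible_components (zariski_topology R) = {spec R}"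
    by (simp add: irreducible_components_def)
  show "generic_point R (spec R) = P"
    unfolding generic_point_def
  proof (rule the_equality)
    show "P \<in> spec R \<and> zariski_topology R closure_of {P} = spec R"
      using assms by (auto simp: zariski_closure_of_point)
    fix Q assume Q: "Q \<in> spec R \<and> zariski_topology R closure_of {Q} = spec R"
    then have "Q \<subseteq> P" using assms(1) zariski_closure_of_point[of Q R] by auto
    then show "Q = P" using assms(2) Q by blast
  qed
qed

section \<open>The length at the generic point\<close>

text \<open>
  The extra axiom says that \<open>a / b\<close> is a fraction with numerator \<open>t\<close> and denominator \<open>s\<close> of value
  \<open>0\<close>. Such denominators are inverted at the generic point, so there the value decides
  divisibility.
\<close>

locale generically_uniserial = truncated_valuation +
  assumes ratio: "a \<in> carrier R \<Longrightarrow> b \<in> carrier R \<Longrightarrow> \<omega> b \<le> \<omega> a \<Longrightarrow>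
    \<exists>s \<in> carrier R. \<exists>t \<in> carrier R. \<omega> s = 0 \<and> s \<otimes> a = t \<otimes> b"
begin

text \<open>
  The truncated valuation extends to the local ring by \<open>\<omega> (a / s) = \<omega> a\<close>, and there it decides
  divisibility, so that the count of ideals above applies.
\<close>

lemma ring_length_local_ring_at:
  "ring_length (local_ring_at R {a \<in> carrier R. 0 < \<omega> a}) = enat L"
proof -
  define P where "P = {a \<in> carrier R. 0 < \<omega> a}"
  have P_prime: "primeideal P R" unfolding P_def by (rule primeideal_positive)
  note P_add_fraction = primeideal.add_fraction[OF P_prime]
    and P_cring_local_ring_at = primeideal.cring_local_ring_at[OF P_prime]
    and P_fraction_cases = primeideal.fraction_cases[OF P_prime]
    and P_fraction_closed = primeideal.fraction_closed[OF P_prime]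
    and P_fraction_eqI = primeideal.fraction_eqI[OF P_prime]
    and P_fraction_eq_iff = primeideal.fraction_eq_iff[OF P_prime]
    and P_mem_fraction = primeideal.mem_fraction[OF P_prime]
    and P_mem_fractionD = primeideal.mem_fractionD[OF P_prime]
    and P_mult_fraction = primeideal.mult_fraction[OF P_prime]
    and P_one_outside = primeideal.one_outside[OF P_prime]
    and P_outside_mult_closed = primeideal.outside_mult_closed[OF P_prime]
    and P_zero_fraction = primeideal.zero_fraction[OF P_prime]
  have out: "s \<in> carrier R - P \<longleftrightarrow> s \<in> carrier R \<and> \<omega> s = 0" for s
    unfolding P_def Diff_iff mem_Collect_eq by auto
  \<comment> \<open>Any representative of the class will do, since denominators have value \<open>0\<close>.\<close>
  define \<nu> where "\<nu> p = \<omega> (fst (SOME x. x \<in> p))" for p :: "('a \<times> 'a) set"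
  have \<nu>: "\<nu> (fraction R P a s) = \<omega> a" if as: "a \<in> carrier R" "s \<in> carrier R - P" for a s
  proof -
    obtain b t where bt: "(SOME x. x \<in> fraction R P a s) = (b, t)" by fastforce
    have "(b, t) \<in> fraction R P a s"
      using someI[of "\<lambda>x. x \<in> fraction R P a s", OF P_mem_fraction[OF as]] by (simp add: bt)
    note b = P_mem_fractionD[OF this]
    obtain u where u: "u \<in> carrier R - P" "u \<otimes> (a \<otimes> t) = u \<otimes> (b \<otimes> s)" using b(5) by blast
    have "\<omega> (u \<otimes> (a \<otimes> t)) = \<omega> a" "\<omega> (u \<otimes> (b \<otimes> s)) = \<omega> b"
      using u(1) b(1-4) out value_le[of a] value_le[of b] by (simp_all add: value_mult)
    with u(2) have "\<omega> a = \<omega> b" by argo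
    then show ?thesis by (simp add: \<nu>_def bt)
  qed
  note closed = P_outside_mult_closed P_one_outside
  interpret L: truncated_valuation "local_ring_at R P" \<nu> L
  proof (intro truncated_valuation.intro truncated_valuation_axioms.intro)
    fix p assume "p \<in> carrier (local_ring_at R P)"
    then obtain a s where p: "a \<in> carrier R" "s \<in> carrier R - P" "p = fraction R P a s"
      by (rule P_fraction_cases)
    show "\<nu> p \<le> L" using p by (simp add: \<nu> value_le)
    have "p = \<zero>\<^bsub>local_ring_at R P\<^esub> \<longleftrightarrow> (\<exists>u \<in> carrier R - P. u \<otimes> (a \<otimes> \<one>) = u \<otimes> (\<zero> \<otimes> s))"
      unfolding p(3) P_zero_fraction by (intro P_fraction_eq_iff p zero_closed P_one_outside)
    also have "\<dots> \<longleftrightarrow> (\<exists>u \<in> carrier R - P. u \<otimes> a = \<zero>)"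
      using p(1,2) by (intro bex_cong) auto
    also have "\<dots> \<longleftrightarrow> \<omega> a = L"
    proof
      assume "\<exists>u \<in> carrier R - P. u \<otimes> a = \<zero>"
      then obtain u where "u \<in> carrier R - P" and ua: "u \<otimes> a = \<zero>" by (rule bexE)
      then have u: "u \<in> carrier R" "\<omega> u = 0" by (simp_all only: out)
      then show "\<omega> a = L" using p(1) u ua value_mult[of u a] value_le[of a] value_zero by simp
    next
      assume "\<omega> a = L"
      then have "\<one> \<otimes> a = \<zero>" using p(1) by (simp add: value_eq_L_iff)
      then show "\<exists>u \<in> carrier R - P. u \<otimes> a = \<zero>" using P_one_outside by (rule bexI)
    qed
    finally show "\<nu> p = L \<longleftrightarrow> p = \<zero>\<^bsub>local_ring_at R P\<^esub>" using p by (simp add: \<nu>)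
    fix q assume "q \<in> carrier (local_ring_at R P)"
    then obtain b t where q: "b \<in> carrier R" "t \<in> carrier R - P" "q = fraction R P b t"
      by (rule P_fraction_cases)
    have "\<omega> (a \<otimes> t) = \<omega> a" "\<omega> (b \<otimes> s) = \<omega> b"
      using p q out value_le[of a] value_le[of b] by (simp_all add: value_mult)
    then have "min (\<omega> a) (\<omega> b) \<le> \<omega> (a \<otimes> t \<oplus> b \<otimes> s)"
      using value_add[of "a \<otimes> t" "b \<otimes> s"] p q by simp
    then show "min (\<nu> p) (\<nu> q) \<le> \<nu> (p \<oplus>\<^bsub>local_ring_at R P\<^esub> q)"
      using p q closed by (simp add: P_add_fraction \<nu>)
    show "\<nu> (p \<otimes>\<^bsub>local_ring_at R P\<^esub> q) = min L (\<nu> p + \<nu> q)"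
      using p q closed by (simp add: P_mult_fraction \<nu> value_mult)
  next
    fix k assume "k \<le> L"
    then obtain a where "a \<in> carrier R" "\<omega> a = k" using value_surj by blast
    then show "\<exists>p \<in> carrier (local_ring_at R P). \<nu> p = k"
      using closed by (intro bexI[of _ "fraction R P a \<one>"]) (auto simp: \<nu> intro: P_fraction_closed)
  qed (use P_cring_local_ring_at L_pos in auto)
  show ?thesis
    unfolding P_def[symmetric]
  proof (rule L.ring_length_eq)
    fix p q assume pq: "p \<in> carrier (local_ring_at R P)" "q \<in> carrier (local_ring_at R P)" "\<nu> q \<le> \<nu> p"
    obtain a s where p: "a \<in> carrier R" "s \<in> carrier R - P" "p = fraction R P a s"
      using pq(1) by (rule P_fraction_cases)
    obtain b t where q: "b \<in> carrier R" "t \<in> carrier R - P" "q = fraction R P b t"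
      using pq(2) by (rule P_fraction_cases)
    have "\<omega> b \<le> \<omega> a" using pq(3) p q by (simp add: \<nu>)
    then obtain u v where uv: "u \<in> carrier R" "v \<in> carrier R" "\<omega> u = 0" "u \<otimes> a = v \<otimes> b"
      using ratio p q by blast
    then have u: "u \<in> carrier R - P" by (simp only: out)
    have "a \<otimes> ((s \<otimes> u) \<otimes> t) = (s \<otimes> t) \<otimes> (u \<otimes> a)" using uv(1,2) p(1,2) q(1,2) by (simp add: m_ac)
    also have "\<dots> = ((v \<otimes> t) \<otimes> b) \<otimes> s" unfolding uv(4) using uv(1,2) p(1,2) q(1,2) by (simp add: m_ac)
    finally have "p = fraction R P ((v \<otimes> t) \<otimes> b) ((s \<otimes> u) \<otimes> t)"
      unfolding p(3) using p(1,2) q(1,2) uv(1,2) u closed by (intro P_fraction_eqI) auto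
    also have "\<dots> = fraction R P (v \<otimes> t) (s \<otimes> u) \<otimes>\<^bsub>local_ring_at R P\<^esub> q"
      unfolding q(3) using p(1,2) q(1,2) uv(1,2) u closed by (intro P_mult_fraction[symmetric]) auto
    finally have "p = fraction R P (v \<otimes> t) (s \<otimes> u) \<otimes>\<^bsub>local_ring_at R P\<^esub> q" .
    then show "\<exists>r \<in> carrier (local_ring_at R P). p = r \<otimes>\<^bsub>local_ring_at R P\<^esub> q"
      using p(1,2) q(1,2) uv(1,2) u closed by (intro bexI[of _ "fraction R P (v \<otimes> t) (s \<otimes> u)"] P_fraction_closed) auto
  qed
qed

lemma sum_component_lengths:
  "(\<Sum>D \<in> irreducible_components (zariski_topology R).
      ring_length (local_ring_at R (generic_point R D))) = enat L"
  using irreducible_spec_if_least_prime[of "{a \<in> carrier R. 0 < \<omega> a}" R]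
    primeideal_positive positive_subset_prime ring_length_local_ring_at by (simp add: spec_def)

end


section \<open>Valuations and their Gauss extensions\<close>

locale valuation =
  fixes v :: "'a::idom \<Rightarrow> int"
  assumes val_mult: "f \<noteq> 0 \<Longrightarrow> g \<noteq> 0 \<Longrightarrow> v (f * g) = v f + v g"
    and val_add: "f \<noteq> 0 \<Longrightarrow> g \<noteq> 0 \<Longrightarrow> f + g \<noteq> 0 \<Longrightarrow> min (v f) (v g) \<le> v (f + g)"

text \<open>
  The value of \<open>0\<close> is infinite in spirit but unspecified in the locale. All later arguments go through
  the sets below, which contain \<open>0\<close> by fiat.
\<close>

definition val_ideal :: "('a::zero \<Rightarrow> int) \<Rightarrow> int \<Rightarrow> 'a set" where
  "val_ideal v k = {f. f = 0 \<or> k \<le> v f}"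

lemma mem_val_ideal_iff: "f \<in> val_ideal v k \<longleftrightarrow> f = 0 \<or> k \<le> v f"
  by (simp add: val_ideal_def)

lemma zero_in_val_ideal [simp]: "0 \<in> val_ideal v k"
  by (simp add: val_ideal_def)

lemma val_ideal_antimono: "j \<le> k \<Longrightarrow> f \<in> val_ideal v k \<Longrightarrow> f \<in> val_ideal v j"
  by (auto simp: val_ideal_def)

context valuation
begin

lemma val_ideal_add: "f \<in> val_ideal v k \<Longrightarrow> g \<in> val_ideal v k \<Longrightarrow> f + g \<in> val_ideal v k"
  using val_add[of f g]
  by (cases "f = 0"; cases "g = 0"; cases "f + g = 0") (simp_all add: val_ideal_def)

lemma val_ideal_mult: "f \<in> val_ideal v j \<Longrightarrow> g \<in> val_ideal v k \<Longrightarrow> f * g \<in> val_ideal v (j + k)"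
  using val_mult[of f g]
  by (cases "f = 0"; cases "g = 0") (simp_all add: val_ideal_def)

lemma val_ideal_sum: "(\<And>i. i \<in> S \<Longrightarrow> f i \<in> val_ideal v k) \<Longrightarrow> sum f S \<in> val_ideal v k"
  by (induction S rule: infinite_finite_induct) (auto intro: val_ideal_add)

lemma val_one: "v 1 = 0"
  using val_mult[of 1 1] by simp

lemma val_uminus: "v (- f) = v f"
proof -
  have "v (-1) = 0" using val_mult[of "-1" "-1"] val_one by simp
  then show ?thesis using val_mult[of "-1" f] by (cases "f = 0") auto
qed

lemma val_ideal_diff: "f \<in> val_ideal v k \<Longrightarrow> g \<in> val_ideal v k \<Longrightarrow> f - g \<in> val_ideal v k"
  using val_ideal_add[of f k "- g"] by (auto simp: mem_val_ideal_iff val_uminus)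

lemma val_power: "f \<noteq> 0 \<Longrightarrow> v (f ^ n) = int n * v f"
  by (induction n) (auto simp: val_one val_mult algebra_simps)

end

text \<open>
  The extension of \<open>v\<close> to polynomials in which the new variable has value \<open>c\<close>. Iterating it, with
  different values of \<open>c\<close>, gives the weighted orders on polynomials in several variables. A negative
  \<open>c\<close> is allowed and will be used for the variable of the Rees algebra.
\<close>

definition gauss :: "int \<Rightarrow> ('a::zero \<Rightarrow> int) \<Rightarrow> 'a poly \<Rightarrow> int" where
  "gauss c v F = Min ((\<lambda>i. v (coeff F i) + c * int i) ` {i. coeff F i \<noteq> 0})"

lemma finite_coeff_support: "finite {i. coeff F i \<noteq> 0}"
  using MOST_coeff_eq_0[of F] by (simp add: MOST_iff_cofinite)

lemma le_gauss_iff: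
  "F \<noteq> 0 \<Longrightarrow> k \<le> gauss c v F \<longleftrightarrow> (\<forall>i. coeff F i \<noteq> 0 \<longrightarrow> k \<le> v (coeff F i) + c * int i)"
  unfolding gauss_def by (subst Min_ge_iff) (auto simp: finite_coeff_support poly_eq_iff)

lemma mem_val_ideal_gauss_iff:
  "F \<in> val_ideal (gauss c v) k \<longleftrightarrow> (\<forall>i. coeff F i \<in> val_ideal v (k - c * int i))"
  by (cases "F = 0") (auto simp: mem_val_ideal_iff le_gauss_iff algebra_simps)

lemma gauss_monom: "a \<noteq> 0 \<Longrightarrow> gauss c v (monom a n) = v a + c * int n"
  by (simp add: gauss_def)

text \<open>The first index at which the minimum is attained, as needed for Gauss's lemma.\<close>

lemma gauss_attained:
  assumes "F \<noteq> 0"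
  obtains i where "coeff F i \<noteq> 0" "gauss c v F = v (coeff F i) + c * int i"
    "\<And>j. j < i \<Longrightarrow> coeff F j \<in> val_ideal v (gauss c v F + 1 - c * int j)"
proof -
  have "gauss c v F \<in> (\<lambda>i. v (coeff F i) + c * int i) ` {i. coeff F i \<noteq> 0}"
    unfolding gauss_def using assms by (intro Min_in) (auto simp: finite_coeff_support poly_eq_iff)
  then have ex: "\<exists>i. coeff F i \<noteq> 0 \<and> gauss c v F = v (coeff F i) + c * int i" by blast
  define i where "i = (LEAST i. coeff F i \<noteq> 0 \<and> gauss c v F = v (coeff F i) + c * int i)"
  have i: "coeff F i \<noteq> 0 \<and> gauss c v F = v (coeff F i) + c * int i"
    unfolding i_def using ex by (rule LeastI_ex)
  show ?thesis
  proof (rule that)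
    fix j assume "j < i"
    then have "coeff F j = 0 \<or> gauss c v F \<noteq> v (coeff F j) + c * int j"
      unfolding i_def using not_less_Least by blast
    moreover have "coeff F j = 0 \<or> gauss c v F \<le> v (coeff F j) + c * int j"
      using le_gauss_iff[OF assms, of "gauss c v F" c v] by auto
    ultimately show "coeff F j \<in> val_ideal v (gauss c v F + 1 - c * int j)"
      by (auto simp: mem_val_ideal_iff)
  qed (use i in auto)
qed

text \<open>
  The argument of Gauss's lemma: if \<open>i\<close> and \<open>j\<close> are the first indices at which \<open>F\<close> and \<open>G\<close> attain
  their values, then among the products contributing to the coefficient of \<open>F * G\<close> at \<open>i + j\<close> the
  one of these two coefficients is the only one of least value, so it cannot be cancelled.
\<close>

lemma valuation_gauss:
  assumes "valuation v"
  shows "valuation (gauss c v)"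
proof
  interpret valuation v by fact
  fix F G :: "'a poly" assume F: "F \<noteq> 0" and G: "G \<noteq> 0"
  define m n where "m = gauss c v F" and "n = gauss c v G"
  have Fm: "coeff F i \<in> val_ideal v (m - c * int i)" for i
    using mem_val_ideal_gauss_iff[of F c v m] by (simp add: m_def mem_val_ideal_iff[of F])
  have Gn: "coeff G i \<in> val_ideal v (n - c * int i)" for i
    using mem_val_ideal_gauss_iff[of G c v n] by (simp add: n_def mem_val_ideal_iff[of G])
  obtain i where i: "coeff F i \<noteq> 0" "m = v (coeff F i) + c * int i"
      "\<And>i'. i' < i \<Longrightarrow> coeff F i' \<in> val_ideal v (m + 1 - c * int i')"
    using gauss_attained[OF F, of c v] unfolding m_def by metis
  obtain j where j: "coeff G j \<noteq> 0" "n = v (coeff G j) + c * int j"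
      "\<And>j'. j' < j \<Longrightarrow> coeff G j' \<in> val_ideal v (n + 1 - c * int j')"
    using gauss_attained[OF G, of c v] unfolding n_def by metis
  have "F * G \<in> val_ideal (gauss c v) (m + n)"
    unfolding mem_val_ideal_gauss_iff
  proof
    fix d
    have "coeff F k * coeff G (d - k) \<in> val_ideal v (m + n - c * int d)" if "k \<le> d" for k
      using val_ideal_mult[OF Fm[of k] Gn[of "d - k"]] that by (simp add: of_nat_diff algebra_simps)
    then show "coeff (F * G) d \<in> val_ideal v (m + n - c * int d)"
      unfolding coeff_mult by (intro val_ideal_sum) auto
  qed
  moreover have "F * G \<notin> val_ideal (gauss c v) (m + n + 1)"
  proof
    let ?d = "i + j" and ?k = "m + n + 1 - c * int (i + j)"
    assume "F * G \<in> val_ideal (gauss c v) (m + n + 1)"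
    then have all: "coeff (F * G) ?d \<in> val_ideal v ?k"
      unfolding mem_val_ideal_gauss_iff by blast
    have rest: "(\<Sum>k\<in>{..?d} - {i}. coeff F k * coeff G (?d - k)) \<in> val_ideal v ?k"
    proof (rule val_ideal_sum)
      fix k assume k: "k \<in> {..?d} - {i}"
      show "coeff F k * coeff G (?d - k) \<in> val_ideal v ?k"
      proof (cases "k < i")
        case True
        then show ?thesis
          using val_ideal_mult[OF i(3)[of k] Gn[of "?d - k"]] k by (simp add: of_nat_diff algebra_simps)
      next
        case False
        with k have "?d - k < j" by auto
        then show ?thesis
          using val_ideal_mult[OF Fm[of k] j(3)[of "?d - k"]] k by (simp add: of_nat_diff algebra_simps)
      qed
    qed
    have "coeff (F * G) ?d = coeff F i * coeff G j + (\<Sum>k\<in>{..?d} - {i}. coeff F k * coeff G (?d - k))"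
      unfolding coeff_mult by (subst sum.remove[of _ i]) auto
    then have "coeff F i * coeff G j \<in> val_ideal v ?k"
      using val_ideal_diff[OF all rest] by simp
    then show False
      using i(1,2) j(1,2) by (simp add: mem_val_ideal_iff val_mult algebra_simps)
  qed
  ultimately show "gauss c v (F * G) = gauss c v F + gauss c v G"
    using F G by (simp add: mem_val_ideal_iff m_def n_def)
  assume "F + G \<noteq> 0"
  moreover have "F + G \<in> val_ideal (gauss c v) (min m n)"
    unfolding mem_val_ideal_gauss_iff coeff_add
    by (intro allI val_ideal_add val_ideal_antimono[OF _ Fm] val_ideal_antimono[OF _ Gn]) auto
  ultimately show "min (gauss c v F) (gauss c v G) \<le> gauss c v (F + G)"
    by (simp add: mem_val_ideal_iff m_def n_def)
qed


section \<open>The normal cone as a quotient of the Rees algebra\<close>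

abbreviation type_ring :: "'a::comm_ring_1 ring" where
  "type_ring \<equiv> ring_of_type_algebra"

lemma type_ring_simps [simp]:
  "carrier type_ring = UNIV" "monoid.mult type_ring = (*)" "one type_ring = 1"
  "zero type_ring = 0" "add type_ring = (+)"
  by (simp_all add: ring_of_type_algebra_def fun_eq_iff)

lemma type_ring_uminus [simp]: "\<ominus>\<^bsub>type_ring\<^esub> (a :: 'a::comm_ring_1) = - a"
proof -
  interpret cring "type_ring :: 'a ring" by (rule cring_from_type_algebra)
  show ?thesis by (rule minus_equality) simp_all
qed

lemma ideal_type_ring_iff:
  "ideal (J :: 'a::comm_ring_1 set) type_ring \<longleftrightarrow>
    0 \<in> J \<and> (\<forall>a\<in>J. \<forall>b\<in>J. a + b \<in> J) \<and> (\<forall>a\<in>J. \<forall>r. r * a \<in> J)"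
proof
  assume J: "ideal J type_ring"
  note sub = ideal.axioms(1)[OF J]
  show "0 \<in> J \<and> (\<forall>a\<in>J. \<forall>b\<in>J. a + b \<in> J) \<and> (\<forall>a\<in>J. \<forall>r. r * a \<in> J)"
    using additive_subgroup.zero_closed[OF sub] additive_subgroup.a_closed[OF sub] ideal.I_l_closed[OF J]
    by simp
next
  interpret cring "type_ring :: 'a ring" by (rule cring_from_type_algebra)
  assume J: "0 \<in> J \<and> (\<forall>a\<in>J. \<forall>b\<in>J. a + b \<in> J) \<and> (\<forall>a\<in>J. \<forall>r. r * a \<in> J)"
  then have "- 1 * a \<in> J" if "a \<in> J" for a using that by blast
  then have "- a \<in> J" if "a \<in> J" for a using that by simp
  then show "ideal J type_ring"
    using J by (intro idealI ring_axioms add.subgroupI) (auto simp: mult.commute)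
qed

lemma ideal_type_ring_diff:
  assumes "ideal (J :: 'a::comm_ring_1 set) type_ring" "a \<in> J" "b \<in> J"
  shows "a - b \<in> J"
proof -
  have "a + - 1 * b \<in> J" using assms unfolding ideal_type_ring_iff by blast
  then show ?thesis by simp
qed

lemma ideal_type_ring_sum:
  assumes "ideal (J :: 'a::comm_ring_1 set) type_ring" "\<And>i. i \<in> S \<Longrightarrow> f i \<in> J"
  shows "sum f S \<in> J"
  using assms unfolding ideal_type_ring_iff by (induction S rule: infinite_finite_induct) auto

lemma coset_type_ring: "J +>\<^bsub>type_ring\<^esub> a = {h + a | h. h \<in> J}"
  by (auto simp: a_r_coset_def')

lemma coset_type_ring_eq_iff:
  assumes "ideal (J :: 'a::comm_ring_1 set) type_ring"
  shows "J +>\<^bsub>type_ring\<^esub> a = J +>\<^bsub>type_ring\<^esub> b \<longleftrightarrow> a - b \<in> J"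
proof
  have J: "0 \<in> J" "\<And>a b. a \<in> J \<Longrightarrow> b \<in> J \<Longrightarrow> a + b \<in> J" "\<And>a b. a \<in> J \<Longrightarrow> b \<in> J \<Longrightarrow> a - b \<in> J"
    using assms ideal_type_ring_diff[OF assms] unfolding ideal_type_ring_iff by blast+
  assume "J +>\<^bsub>type_ring\<^esub> a = J +>\<^bsub>type_ring\<^esub> b"
  moreover have "a \<in> J +>\<^bsub>type_ring\<^esub> a" using J(1) by (force simp: coset_type_ring)
  ultimately have "a \<in> J +>\<^bsub>type_ring\<^esub> b" by simp
  then show "a - b \<in> J" by (auto simp: coset_type_ring)
next
  have J: "0 \<in> J" "\<And>a b. a \<in> J \<Longrightarrow> b \<in> J \<Longrightarrow> a + b \<in> J" "\<And>a b. a \<in> J \<Longrightarrow> b \<in> J \<Longrightarrow> a - b \<in> J"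
    using assms ideal_type_ring_diff[OF assms] unfolding ideal_type_ring_iff by blast+
  assume ab: "a - b \<in> J"
  have "\<exists>h'. h + a = h' + b \<and> h' \<in> J" "\<exists>h'. h + b = h' + a \<and> h' \<in> J" if "h \<in> J" for h
    using J(2)[OF that ab] J(3)[OF that ab] by (force simp: algebra_simps)+
  then show "J +>\<^bsub>type_ring\<^esub> a = J +>\<^bsub>type_ring\<^esub> b" by (auto simp: coset_type_ring)
qed

lemma coset_type_ring_zero: "J +>\<^bsub>type_ring\<^esub> (0 :: 'a::comm_ring_1) = J"
  by (simp add: coset_type_ring)

lemma coset_type_ring_add:
  assumes "ideal (J :: 'a::comm_ring_1 set) type_ring"
  shows "(J +>\<^bsub>type_ring\<^esub> a) <+>\<^bsub>type_ring\<^esub> (J +>\<^bsub>type_ring\<^esub> b) = J +>\<^bsub>type_ring\<^esub> (a + b)"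
proof -
  interpret ideal J type_ring by fact
  show ?thesis using a_rcos_sum[of a b] by simp
qed

lemma finsum_cosets:
  assumes "ideal (J :: 'a::comm_ring_1 set) type_ring"
  shows "(\<Oplus>\<^bsub>type_ring Quot J\<^esub> i \<in> {..n::nat}. J +>\<^bsub>type_ring\<^esub> f i) = J +>\<^bsub>type_ring\<^esub> (\<Sum>i\<le>n. f i)"
proof -
  interpret J: ideal J type_ring by fact
  interpret Q: ring "type_ring Quot J" by (rule J.quotient_is_ring)
  have [simp]: "J +>\<^bsub>type_ring\<^esub> a \<in> carrier (type_ring Quot J)" for a
    by (auto simp: FactRing_def A_RCOSETS_def')
  have add: "x \<oplus>\<^bsub>type_ring Quot J\<^esub> y = x <+>\<^bsub>type_ring\<^esub> y" for x y
    by (simp add: FactRing_def)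
  show ?thesis
  proof (induction n)
    case 0
    show ?case by (simp add: Q.finsum_0)
  next
    case (Suc n)
    then show ?case
      by (simp add: Q.finsum_Suc add coset_type_ring_add[OF assms] add.commute)
  qed
qed

lemma ideals_set_monoid: "monoid (ideals_set (type_ring :: 'a::comm_ring_1 ring))"
proof -
  interpret cring "type_ring :: 'a ring" by (rule cring_from_type_algebra)
  show ?thesis using ideals_set_is_comm_monoid by (rule comm_monoid.axioms)
qed

text \<open>
  Powers of ideals are kept folded: the simplifier would otherwise rewrite \<open>I^(d+1)\<close> into a product
  in the monoid of ideals, to which the lemmas below do not apply.
\<close>

declare nat_pow_0 [simp del] nat_pow_Suc [simp del]

lemma ideal_power_0: "ideal_power type_ring I 0 = UNIV"
  by (simp add: nat_pow_def) (simp add: ideals_set_def)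

lemma ideal_power_Suc: "ideal_power type_ring I (Suc d) = ideal_prod type_ring (ideal_power type_ring I d) I"
  by (simp add: nat_pow_def) (simp add: ideals_set_def)

text \<open>
  A family \<open>(a\<^sub>d)\<close> with \<open>a\<^sub>d \<in> I\<^sup>d\<close> is stored as the polynomial with coefficients \<open>a\<^sub>d\<close>. Passing to the
  classes modulo \<open>I^(d+1)\<close> maps this ring onto the normal cone, which makes the ring laws of the
  cone consequences of those for polynomials.
\<close>

definition rees_ring :: "'a::comm_ring_1 set \<Rightarrow> 'a poly ring" where
  "rees_ring I = type_ring\<lparr>carrier := {F. \<forall>d. coeff F d \<in> ideal_power type_ring I d}\<rparr>"

definition initial_form :: "'a::comm_ring_1 set \<Rightarrow> 'a poly \<Rightarrow> nat \<Rightarrow> 'a set" where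
  "initial_form I F = (\<lambda>d. ideal_power type_ring I (Suc d) +>\<^bsub>type_ring\<^esub> coeff F d)"

lemma mem_rees_ring_iff: "F \<in> carrier (rees_ring I) \<longleftrightarrow> (\<forall>d. coeff F d \<in> ideal_power type_ring I d)"
  by (simp add: rees_ring_def)

lemma rees_ring_simps [simp]:
  "monoid.mult (rees_ring I) = (*)" "one (rees_ring I) = 1" "zero (rees_ring I) = 0" "add (rees_ring I) = (+)"
  by (simp_all add: rees_ring_def)

lemma initial_form_zero: "initial_form I 0 = \<zero>\<^bsub>normal_cone_ring type_ring I\<^esub>"
  by (auto simp: normal_cone_ring_def initial_form_def coset_type_ring_zero)

context
  fixes I :: "'a::comm_ring_1 set"
  assumes I: "ideal I type_ring"
begin

lemma ideal_ideal_power: "ideal (ideal_power type_ring I d) type_ring"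
proof -
  interpret monoid "ideals_set (type_ring :: 'a ring)" by (rule ideals_set_monoid)
  show ?thesis using nat_pow_closed[of I d] I by (simp add: ideals_set_def)
qed

lemma mult_mem_ideal_power:
  assumes "a \<in> ideal_power type_ring I i" "b \<in> ideal_power type_ring I j"
  shows "a * b \<in> ideal_power type_ring I (i + j)"
proof -
  interpret monoid "ideals_set (type_ring :: 'a ring)" by (rule ideals_set_monoid)
  have "ideal_prod type_ring (ideal_power type_ring I i) (ideal_power type_ring I j) =
      ideal_power type_ring I (i + j)"
    using nat_pow_mult[of I i j] I by (simp add: ideals_set_def)
  then show ?thesis using ideal_prod.prod[of a _ b _ type_ring] assms by fastforce
qed

lemma ideal_power_antimono: "ideal_power type_ring I (Suc d) \<subseteq> ideal_power type_ring I d"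
proof -
  interpret cring "type_ring :: 'a ring" by (rule cring_from_type_algebra)
  show ?thesis
    unfolding ideal_power_Suc using ideal_prod_inter[OF ideal_ideal_power I] by blast
qed

lemma cring_rees_ring: "cring (rees_ring I)"
proof -
  let ?H = "{F. \<forall>d. poly.coeff F d \<in> ideal_power type_ring I d}"
  interpret cring "type_ring :: 'a poly ring" by (rule cring_from_type_algebra)
  note N = ideal_ideal_power[unfolded ideal_type_ring_iff]
  have one: "poly.coeff 1 d \<in> ideal_power type_ring I d" for d
    using N[of d] by (cases d) (simp_all add: ideal_power_0 coeff_1)
  have "subring ?H type_ring"
  proof (rule subringI)
    show "\<one>\<^bsub>type_ring\<^esub> \<in> ?H" using one by simp
    fix F G assume F: "F \<in> ?H" and G: "G \<in> ?H"
    have "0 - poly.coeff F d \<in> ideal_power type_ring I d" for d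
      using F N[of d] by (intro ideal_type_ring_diff[OF ideal_ideal_power]) auto
    then show "\<ominus>\<^bsub>type_ring\<^esub> F \<in> ?H" by simp
    show "F \<oplus>\<^bsub>type_ring\<^esub> G \<in> ?H" using F G N by simp
    have "poly.coeff F i * poly.coeff G (d - i) \<in> ideal_power type_ring I d" if "i \<le> d" for i d
      using mult_mem_ideal_power[of "poly.coeff F i" i "poly.coeff G (d - i)" "d - i"] F G that by simp
    then have "poly.coeff (F * G) d \<in> ideal_power type_ring I d" for d
      unfolding coeff_mult by (intro ideal_type_ring_sum[OF ideal_ideal_power]) auto
    then show "F \<otimes>\<^bsub>type_ring\<^esub> G \<in> ?H" by simp
  qed simp
  then show ?thesis
    unfolding rees_ring_def by (subst subcring_iff[symmetric]) (auto intro: subcringI')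
qed

lemma initial_form_eq_iff:
  "initial_form I F = initial_form I G \<longleftrightarrow> (\<forall>d. coeff (F - G) d \<in> ideal_power type_ring I (Suc d))"
  by (simp add: initial_form_def fun_eq_iff coset_type_ring_eq_iff[OF ideal_ideal_power])

text \<open>
  The factors are cosets of \<open>I^(i+1)\<close> and \<open>I^(j+1)\<close>, whereas the product is taken modulo the smaller
  ideal \<open>I^(i+j+1)\<close>. It is still a single coset, because the factors lie in \<open>I^i\<close> and \<open>I^j\<close>.
\<close>

lemma rcoset_mult_initial_forms:
  assumes "a \<in> ideal_power type_ring I i" "b \<in> ideal_power type_ring I j"
  shows "rcoset_mult type_ring (ideal_power type_ring I (Suc (i + j)))
      (ideal_power type_ring I (Suc i) +>\<^bsub>type_ring\<^esub> a) (ideal_power type_ring I (Suc j) +>\<^bsub>type_ring\<^esub> b)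
    = ideal_power type_ring I (Suc (i + j)) +>\<^bsub>type_ring\<^esub> (a * b)"
proof -
  let ?N = "ideal_power type_ring I" let ?J = "?N (Suc (i + j))"
  note N = ideal_ideal_power[unfolded ideal_type_ring_iff]
  have "?J +>\<^bsub>type_ring\<^esub> (a' * b') = ?J +>\<^bsub>type_ring\<^esub> (a * b)"
    if a': "a' \<in> ?N (Suc i) +>\<^bsub>type_ring\<^esub> a" and b': "b' \<in> ?N (Suc j) +>\<^bsub>type_ring\<^esub> b" for a' b'
  proof -
    obtain h k where h: "h \<in> ?N (Suc i)" "a' = h + a" and k: "k \<in> ?N (Suc j)" "b' = k + b"
      using a' b' by (auto simp: coset_type_ring)
    have "b' \<in> ?N j" using k ideal_power_antimono[of j] N[of j] assms(2) by auto
    then have "h * b' \<in> ?J" "a * k \<in> ?J"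
      using mult_mem_ideal_power[OF h(1)] mult_mem_ideal_power[OF assms(1) k(1)] by auto
    then have "h * b' + a * k \<in> ?J" using N by blast
    moreover have "a' * b' - a * b = h * b' + a * k" by (simp add: h k algebra_simps)
    ultimately show ?thesis by (simp add: coset_type_ring_eq_iff[OF ideal_ideal_power])
  qed
  moreover have "a \<in> ?N (Suc i) +>\<^bsub>type_ring\<^esub> a" "b \<in> ?N (Suc j) +>\<^bsub>type_ring\<^esub> b"
    using N[of "Suc i"] N[of "Suc j"] by (force simp: coset_type_ring)+
  ultimately show ?thesis unfolding rcoset_mult_def type_ring_simps by blast
qed

lemma initial_form_hom: "initial_form I \<in> ring_hom (rees_ring I) (normal_cone_ring type_ring I)"
proof (rule ring_hom_memI)
  let ?N = "ideal_power type_ring I"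
  fix F G assume F: "F \<in> carrier (rees_ring I)" and G: "G \<in> carrier (rees_ring I)"
  have "{d. initial_form I F d \<noteq> ?N (Suc d)} \<subseteq> {..degree F}"
    by (auto simp: initial_form_def coset_type_ring_zero intro!: leI dest: coeff_eq_0)
  then have "finite {d. initial_form I F d \<noteq> ?N (Suc d)}" by (rule finite_subset) simp
  then show "initial_form I F \<in> carrier (normal_cone_ring type_ring I)"
    using F by (auto simp: normal_cone_ring_def mem_rees_ring_iff initial_form_def)
  show "initial_form I (F \<oplus>\<^bsub>rees_ring I\<^esub> G) =
      initial_form I F \<oplus>\<^bsub>normal_cone_ring type_ring I\<^esub> initial_form I G"
    by (simp add: normal_cone_ring_def initial_form_def coset_type_ring_add[OF ideal_ideal_power])
  have mult: "rcoset_mult type_ring (?N (Suc d)) (initial_form I F i) (initial_form I G (d - i)) =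
      ?N (Suc d) +>\<^bsub>type_ring\<^esub> (coeff F i * coeff G (d - i))" if "i \<le> d" for d i
    using rcoset_mult_initial_forms[of "coeff F i" i "coeff G (d - i)" "d - i"] F G that
    by (simp add: mem_rees_ring_iff initial_form_def)
  have "(\<Oplus>\<^bsub>type_ring Quot ?N (Suc d)\<^esub> i \<in> {..d}.
        rcoset_mult type_ring (?N (Suc d)) (initial_form I F i) (initial_form I G (d - i))) =
      (\<Oplus>\<^bsub>type_ring Quot ?N (Suc d)\<^esub> i \<in> {..d}. ?N (Suc d) +>\<^bsub>type_ring\<^esub> (coeff F i * coeff G (d - i)))" for d
  proof -
    interpret J: ideal "?N (Suc d)" type_ring by (rule ideal_ideal_power)
    interpret Q: ring "type_ring Quot ?N (Suc d)" by (rule J.quotient_is_ring)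
    show ?thesis
      by (intro Q.finsum_cong') (auto simp: mult FactRing_def A_RCOSETS_def')
  qed
  then show "initial_form I (F \<otimes>\<^bsub>rees_ring I\<^esub> G) =
      initial_form I F \<otimes>\<^bsub>normal_cone_ring type_ring I\<^esub> initial_form I G"
    by (simp add: normal_cone_ring_def finsum_cosets[OF ideal_ideal_power] initial_form_def coeff_mult)
next
  show "initial_form I \<one>\<^bsub>rees_ring I\<^esub> = \<one>\<^bsub>normal_cone_ring type_ring I\<^esub>"
    by (auto simp: normal_cone_ring_def initial_form_def fun_eq_iff coeff_1 coset_type_ring_zero)
qed

lemma initial_form_surj:
  assumes "f \<in> carrier (normal_cone_ring type_ring I)"
  obtains F where "F \<in> carrier (rees_ring I)" "f = initial_form I F"
proof -
  let ?N = "ideal_power type_ring I"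
  have "\<forall>d. \<exists>a \<in> ?N d. f d = ?N (Suc d) +>\<^bsub>type_ring\<^esub> a" and fin: "finite {d. f d \<noteq> ?N (Suc d)}"
    using assms by (auto simp: normal_cone_ring_def)
  then obtain a where a: "\<And>d. a d \<in> ?N d" "\<And>d. f d = ?N (Suc d) +>\<^bsub>type_ring\<^esub> a d" by metis
  define b where "b d = (if f d = ?N (Suc d) then 0 else a d)" for d
  have "\<forall>\<^sub>\<infinity>d. b d = 0"
    unfolding MOST_iff_cofinite by (rule finite_subset[OF _ fin]) (auto simp: b_def)
  then have coeff: "coeff (Abs_poly b) = b" by (simp add: Abs_poly_inverse)
  show ?thesis
  proof (rule that)
    have "0 \<in> ?N d" for d using ideal_ideal_power[of d] unfolding ideal_type_ring_iff by blast
    then show "Abs_poly b \<in> carrier (rees_ring I)"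
      using a(1) by (simp add: mem_rees_ring_iff coeff b_def)
    show "f = initial_form I (Abs_poly b)"
      using a(2) by (auto simp: fun_eq_iff initial_form_def coeff b_def coset_type_ring_zero)
  qed
qed

lemma cring_normal_cone_ring: "cring (normal_cone_ring type_ring I)"
proof -
  let ?C = "normal_cone_ring type_ring I"
  interpret R: cring "rees_ring I" by (rule cring_rees_ring)
  have img: "initial_form I ` carrier (rees_ring I) = carrier ?C"
    using initial_form_hom initial_form_surj by (auto simp: ring_hom_def)
  have zero: "initial_form I \<zero>\<^bsub>rees_ring I\<^esub> = \<zero>\<^bsub>?C\<^esub>"
    by (simp add: initial_form_zero)
  have "ring ?C"
    using R.ring_hom_imp_img_ring[OF initial_form_hom] unfolding img zero by simp
  then interpret C: ring ?C .
  have "comm_monoid ?C"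
  proof (rule C.monoid_comm_monoidI)
    fix f g assume "f \<in> carrier ?C" "g \<in> carrier ?C"
    then obtain F G where "F \<in> carrier (rees_ring I)" "f = initial_form I F"
      "G \<in> carrier (rees_ring I)" "g = initial_form I G" using initial_form_surj by metis
    then show "f \<otimes>\<^bsub>?C\<^esub> g = g \<otimes>\<^bsub>?C\<^esub> f"
      using R.m_comm ring_hom_mult[OF initial_form_hom] by metis
  qed
  then show ?thesis by (intro cring.intro C.ring_axioms)
qed

end



section \<open>Ideals whose powers are the ideals of a valuation\<close>

text \<open>
  Let \<open>V\<close> extend \<open>v\<close> to polynomials in \<open>T\<close> with \<open>V T = - L\<close>. A polynomial has coefficients \<open>a\<^sub>d\<close> with
  \<open>v a\<^sub>d \<ge> d L\<close> iff \<open>V \<ge> 0\<close>, and with \<open>v a\<^sub>d \<ge> (d + 1) L\<close> iff \<open>V \<ge> L\<close>. So the Rees ring is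
  \<open>{V \<ge> 0}\<close>, its quotient by \<open>{V \<ge> L}\<close> is the normal cone, and \<open>V\<close> cut off at \<open>L\<close> is well defined
  on the cone.
\<close>

lemma (in valuation) normal_cone_generically_uniserial:
  assumes I: "ideal I type_ring" and L: "0 < L"
    and pow: "\<And>d. ideal_power type_ring I d = val_ideal v (int d * int L)"
    and surj: "\<And>k. \<exists>F. F \<noteq> 0 \<and> gauss (- int L) v F = k"
  shows "\<exists>\<omega>. generically_uniserial (normal_cone_ring type_ring I) \<omega> L"
proof -
  let ?C = "normal_cone_ring type_ring I" and ?R = "rees_ring I" and ?V = "gauss (- int L) v"
  let ?\<phi> = "initial_form I"
  interpret V: valuation ?V by (rule valuation_gauss) (rule valuation_axioms)
  interpret R: cring ?R by (rule cring_rees_ring[OF I])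
  note hom = initial_form_hom[OF I]
  have R: "F \<in> carrier ?R \<longleftrightarrow> F \<in> val_ideal ?V 0" for F
    by (simp add: mem_rees_ring_iff mem_val_ideal_gauss_iff pow mult.commute)
  have ker: "?\<phi> F = ?\<phi> G \<longleftrightarrow> F - G \<in> val_ideal ?V (int L)" for F G
    by (simp add: initial_form_eq_iff[OF I] mem_val_ideal_gauss_iff pow algebra_simps)
  define \<tau> where "\<tau> F = (if F = 0 then L else nat (min (?V F) (int L)))" for F
  have \<tau>_le: "\<tau> F \<le> L" for F by (auto simp: \<tau>_def)
  have \<tau>_iff: "k \<le> \<tau> F \<longleftrightarrow> F \<in> val_ideal ?V (int k)" if "k \<le> L" "F \<in> carrier ?R" for k F
    using that by (auto simp: \<tau>_def mem_val_ideal_iff R)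
  define \<omega> where "\<omega> z = \<tau> (SOME F. F \<in> carrier ?R \<and> ?\<phi> F = z)" for z
  have \<omega>: "\<omega> (?\<phi> F) = \<tau> F" if F: "F \<in> carrier ?R" for F
  proof -
    define G where "G = (SOME G. G \<in> carrier ?R \<and> ?\<phi> G = ?\<phi> F)"
    have G: "G \<in> carrier ?R" "?\<phi> G = ?\<phi> F"
      using someI[of "\<lambda>G. G \<in> carrier ?R \<and> ?\<phi> G = ?\<phi> F" F] F unfolding G_def by auto
    have d: "G - F \<in> val_ideal ?V (int k)" if "k \<le> L" for k
      using G(2) that val_ideal_antimono[of "int k" "int L" "G - F" ?V] by (simp add: ker)
    have iff: "G \<in> val_ideal ?V (int k) \<longleftrightarrow> F \<in> val_ideal ?V (int k)" if "k \<le> L" for k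
      using V.val_ideal_add[OF d[OF that], of F] V.val_ideal_diff[OF _ d[OF that], of G] by auto
    have "\<tau> F \<le> \<tau> G" using \<tau>_iff[of "\<tau> F"] \<tau>_le F G(1) iff by auto
    moreover have "\<tau> G \<le> \<tau> F" using \<tau>_iff[of "\<tau> G"] \<tau>_le F G(1) iff by auto
    ultimately show ?thesis unfolding \<omega>_def G_def by simp
  qed
  have "truncated_valuation ?C \<omega> L"
  proof (intro truncated_valuation.intro truncated_valuation_axioms.intro)
    show "cring ?C" by (rule cring_normal_cone_ring[OF I])
    fix x assume "x \<in> carrier ?C"
    then obtain F where F: "F \<in> carrier ?R" "x = ?\<phi> F" by (rule initial_form_surj[OF I])
    show "\<omega> x \<le> L" using F by (simp add: \<omega> \<tau>_le)
    have "\<tau> F = L \<longleftrightarrow> F \<in> val_ideal ?V (int L)"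
      using \<tau>_iff[of L F] \<tau>_le[of F] F(1) by auto
    then show "\<omega> x = L \<longleftrightarrow> x = \<zero>\<^bsub>?C\<^esub>"
      using F ker[of F 0] by (simp add: \<omega> initial_form_zero[symmetric])
    fix y assume "y \<in> carrier ?C"
    then obtain G where G: "G \<in> carrier ?R" "y = ?\<phi> G" by (rule initial_form_surj[OF I])
    have "F \<in> val_ideal ?V (int (min (\<tau> F) (\<tau> G)))" "G \<in> val_ideal ?V (int (min (\<tau> F) (\<tau> G)))"
      using \<tau>_iff[OF _ F(1), of "min (\<tau> F) (\<tau> G)"] \<tau>_iff[OF _ G(1), of "min (\<tau> F) (\<tau> G)"]
        \<tau>_le[of F] by auto
    then have "min (\<tau> F) (\<tau> G) \<le> \<tau> (F + G)"
      using \<tau>_iff[of "min (\<tau> F) (\<tau> G)" "F + G"] V.val_ideal_add R.add.m_closed[OF F(1) G(1)] \<tau>_le[of F]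
      by simp
    moreover have "x \<oplus>\<^bsub>?C\<^esub> y = ?\<phi> (F + G)"
      using ring_hom_add[OF hom F(1) G(1)] F(2) G(2) by simp
    ultimately show "min (\<omega> x) (\<omega> y) \<le> \<omega> (x \<oplus>\<^bsub>?C\<^esub> y)"
      using F G \<omega> R.add.m_closed[OF F(1) G(1)] by simp
    have "\<tau> (F * G) = min L (\<tau> F + \<tau> G)"
    proof (cases "F = 0 \<or> G = 0")
      case True
      then show ?thesis by (auto simp: \<tau>_def)
    next
      case False
      then have "0 \<le> ?V F" "0 \<le> ?V G" using F G by (auto simp: R mem_val_ideal_iff)
      then obtain m n where mn: "?V F = int m" "?V G = int n" by (meson nonneg_int_cases)
      then have "?V (F * G) = int (m + n)" using False by (simp add: V.val_mult)
      then have "\<tau> F = min m L" "\<tau> G = min n L" "\<tau> (F * G) = min (m + n) L"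
        unfolding \<tau>_def using False mn by (simp_all only: of_nat_min[symmetric] nat_int) simp_all
      then show ?thesis by simp
    qed
    moreover have "x \<otimes>\<^bsub>?C\<^esub> y = ?\<phi> (F * G)"
      using ring_hom_mult[OF hom F(1) G(1)] F(2) G(2) by simp
    ultimately show "\<omega> (x \<otimes>\<^bsub>?C\<^esub> y) = min L (\<omega> x + \<omega> y)"
      using F G \<omega> R.m_closed[OF F(1) G(1)] by simp
  next
    fix k assume k: "k \<le> L"
    obtain F where "F \<noteq> 0" "?V F = int k" using surj by blast
    then have "F \<in> carrier ?R" "\<tau> F = k" using k by (auto simp: R mem_val_ideal_iff \<tau>_def)
    then show "\<exists>x \<in> carrier ?C. \<omega> x = k" using \<omega> ring_hom_closed[OF hom] by blast
  qed (rule L)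
  moreover have "\<exists>s \<in> carrier ?C. \<exists>t \<in> carrier ?C. \<omega> s = 0 \<and> s \<otimes>\<^bsub>?C\<^esub> x = t \<otimes>\<^bsub>?C\<^esub> y"
    if xy: "x \<in> carrier ?C" "y \<in> carrier ?C" "\<omega> y \<le> \<omega> x" for x y
  proof -
    obtain F where F: "F \<in> carrier ?R" "x = ?\<phi> F" using xy(1) by (rule initial_form_surj[OF I])
    obtain G where G: "G \<in> carrier ?R" "y = ?\<phi> G" using xy(2) by (rule initial_form_surj[OF I])
    have le: "\<tau> G \<le> \<tau> F" using xy(3) F G by (simp add: \<omega>)
    have "\<exists>S \<in> carrier ?R. \<exists>T \<in> carrier ?R. \<tau> S = 0 \<and> S * F - T * G \<in> val_ideal ?V (int L)"
    proof (cases "\<tau> G = L")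
      case True
      then have "F \<in> val_ideal ?V (int L)" using le \<tau>_le[of F] \<tau>_iff[of L F] F(1) by auto
      moreover have "1 \<in> carrier ?R" "0 \<in> carrier ?R" using R.one_closed R.zero_closed by simp_all
      ultimately show ?thesis by (intro bexI[of _ 1] bexI[of _ 0]) (auto simp: \<tau>_def V.val_one)
    next
      case False
      then have G0: "G \<noteq> 0" "?V G < int L" "0 \<le> ?V G"
        using G(1) by (auto simp: \<tau>_def R mem_val_ideal_iff split: if_splits)
      then have "int (\<tau> G) = ?V G" by (simp add: \<tau>_def)
      moreover have "F \<in> val_ideal ?V (int (\<tau> G))" using \<tau>_iff[OF \<tau>_le F(1)] le by simp
      ultimately have FG: "F = 0 \<or> ?V G \<le> ?V F" by (simp add: mem_val_ideal_iff)
      \<comment> \<open>\<open>Q\<close> may have negative value, but \<open>Q * G\<close> and \<open>Q * F\<close> are in the Rees ring, and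
        \<open>F / G = (Q * F) / (Q * G)\<close>.\<close>
      obtain Q where Q: "Q \<noteq> 0" "?V Q = - ?V G" using surj by blast
      have "Q * F \<in> carrier ?R"
        using Q FG by (cases "F = 0") (simp_all add: R mem_val_ideal_iff V.val_mult)
      moreover have "Q * G \<in> carrier ?R" "\<tau> (Q * G) = 0"
        using Q G0 by (simp_all add: R mem_val_ideal_iff V.val_mult \<tau>_def)
      ultimately show ?thesis by (intro bexI[of _ "Q * G"] bexI[of _ "Q * F"]) (simp_all add: mult_ac)
    qed
    then obtain S T where ST: "S \<in> carrier ?R" "T \<in> carrier ?R" "\<tau> S = 0"
      "S * F - T * G \<in> val_ideal ?V (int L)" by blast
    have "?\<phi> S \<otimes>\<^bsub>?C\<^esub> x = ?\<phi> (S * F)"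
      using ring_hom_mult[OF hom ST(1) F(1)] F(2) by simp
    also have "\<dots> = ?\<phi> (T * G)" using ST(4) by (simp only: ker)
    also have "\<dots> = ?\<phi> T \<otimes>\<^bsub>?C\<^esub> y"
      using ring_hom_mult[OF hom ST(2) G(1)] G(2) by simp
    finally have "?\<phi> S \<otimes>\<^bsub>?C\<^esub> x = ?\<phi> T \<otimes>\<^bsub>?C\<^esub> y" .
    moreover have "\<omega> (?\<phi> S) = 0" using \<omega>[OF ST(1)] ST(3) by simp
    ultimately show ?thesis
      by (intro bexI[of _ "?\<phi> S"] bexI[of _ "?\<phi> T"] conjI ring_hom_closed[OF hom] ST)
  qed
  ultimately show ?thesis
    by (intro exI[of _ \<omega>] generically_uniserial.intro generically_uniserial_axioms.intro)
qed

corollary (in valuation) behrend_number_eq: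
  assumes "ideal I type_ring" "0 < L"
    and "\<And>d. ideal_power type_ring I d = val_ideal v (int d * int L)"
    and "\<And>k. \<exists>F. F \<noteq> 0 \<and> gauss (- int L) v F = k"
  shows "behrend_number type_ring I = enat L"
  using normal_cone_generically_uniserial[OF assms] generically_uniserial.sum_component_lengths
  unfolding behrend_number_def Let_def by blast


section \<open>Weighted orders of polynomials in two variables\<close>

text \<open>The order for which \<open>x\<^sup>a y\<^sup>b\<close> has value \<open>p a + q b\<close>; the outer variable is \<open>y\<close>.\<close>

definition weight :: "nat \<Rightarrow> nat \<Rightarrow> 'a::idom poly poly \<Rightarrow> int" where
  "weight p q = gauss (int q) (gauss (int p) (\<lambda>_. 0))"

abbreviation monomial :: "nat \<Rightarrow> nat \<Rightarrow> 'a::idom poly poly" where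
  "monomial a b \<equiv> monom (monom 1 a) b"

lemma valuation_weight: "valuation (weight p q)"
  unfolding weight_def by (intro valuation_gauss) (simp add: valuation_def)

lemma mem_weight_ideal_iff:
  "f \<in> val_ideal (weight p q) k \<longleftrightarrow>
    (\<forall>a b. coeff (coeff f b) a \<noteq> 0 \<longrightarrow> k \<le> int p * int a + int q * int b)"
proof -
  have "k - int q * int b - int p * int a \<le> 0 \<longleftrightarrow> k \<le> int p * int a + int q * int b" for a b
    by linarith
  then show ?thesis
    unfolding weight_def mem_val_ideal_gauss_iff by (simp only: mem_val_ideal_iff) blast
qed

lemma weight_monomial: "weight p q (monomial a b) = int p * int a + int q * int b"
  by (simp add: weight_def gauss_monom)

lemma mem_ideal_if_monomials:
  fixes f :: "'a::idom poly poly"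
  assumes J: "ideal J type_ring"
    and mon: "\<And>a b. coeff (coeff f b) a \<noteq> 0 \<Longrightarrow> monomial a b \<in> J"
  shows "f \<in> J"
proof -
  have "monom (monom (coeff (coeff f b) a) a) b \<in> J" for a b
  proof (cases "coeff (coeff f b) a = 0")
    case True
    then show ?thesis using J by (simp add: ideal_type_ring_iff)
  next
    case False
    have "monom (monom (coeff (coeff f b) a) a) b = monom (monom (coeff (coeff f b) a) 0) 0 * monomial a b"
      by (simp add: mult_monom)
    then show ?thesis using mon[OF False] J unfolding ideal_type_ring_iff by metis
  qed
  then have "monom (\<Sum>a\<le>degree (coeff f b). monom (coeff (coeff f b) a) a) b \<in> J" for b
    unfolding monom_sum by (intro ideal_type_ring_sum[OF J])
  then have "monom (coeff f b) b \<in> J" for b by (simp only: poly_as_sum_of_monoms)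
  then have "(\<Sum>b\<le>degree f. monom (coeff f b) b) \<in> J" by (intro ideal_type_ring_sum[OF J])
  then show ?thesis by (simp only: poly_as_sum_of_monoms)
qed

lemma ideal_weight: "0 \<le> k \<Longrightarrow> ideal (val_ideal (weight p q :: 'a::idom poly poly \<Rightarrow> int) k) type_ring"
proof -
  interpret valuation "weight p q :: 'a poly poly \<Rightarrow> int" by (rule valuation_weight)
  have "r \<in> val_ideal (weight p q) 0" for r :: "'a poly poly" by (simp add: mem_weight_ideal_iff)
  then show ?thesis
    using val_ideal_mult[of _ 0 _ k] by (auto simp: ideal_type_ring_iff val_ideal_add)
qed

text \<open>
  Powers of integrally closed ideals in two variables are again integrally closed; for monomial ideals
  with a single slope this is elementary. A monomial of weight at least \<open>(d + 1) L\<close> with \<open>d > 0\<close>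
  has weight at least \<open>2 L\<close>, so it is divisible by \<open>x^(g q)\<close> or by \<open>y^(g p)\<close>, both of weight exactly
  \<open>L\<close>: the monomials divisible by neither have weight less than \<open>2 L\<close>.
\<close>

lemma ideal_power_weight:
  fixes p q g d :: nat
  defines "w \<equiv> (weight p q :: 'a::idom poly poly \<Rightarrow> int)" and "L \<equiv> g * p * q"
  shows "ideal_power type_ring (val_ideal w (int L)) d = val_ideal w (int d * int L)"
proof -
  let ?I = "val_ideal w (int L)"
  interpret valuation w unfolding w_def by (rule valuation_weight)
  interpret cring "type_ring :: 'a poly poly ring" by (rule cring_from_type_algebra)
  have I: "ideal ?I type_ring" unfolding w_def by (rule ideal_weight) simp
  show ?thesis
  proof (induction d)
    case 0
    show ?case by (auto simp: ideal_power_0 w_def mem_weight_ideal_iff)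
  next
    case (Suc d)
    let ?J = "val_ideal w (int d * int L)"
    have J: "ideal ?J type_ring" unfolding w_def by (rule ideal_weight) simp
    have "ideal_prod type_ring ?J ?I = val_ideal w (int (Suc d) * int L)"
    proof
      show "ideal_prod type_ring ?J ?I \<subseteq> val_ideal w (int (Suc d) * int L)"
      proof
        fix f assume "f \<in> ideal_prod type_ring ?J ?I"
        then show "f \<in> val_ideal w (int (Suc d) * int L)"
        proof induction
          case (prod i j)
          then show ?case using val_ideal_mult[OF prod] by (simp add: algebra_simps)
        qed (simp add: val_ideal_add)
      qed
      show "val_ideal w (int (Suc d) * int L) \<subseteq> ideal_prod type_ring ?J ?I"
      proof
        fix f assume f: "f \<in> val_ideal w (int (Suc d) * int L)"
        show "f \<in> ideal_prod type_ring ?J ?I"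
        proof (rule mem_ideal_if_monomials)
          show "ideal (ideal_prod type_ring ?J ?I) type_ring" by (rule ideal_prod_is_ideal[OF J I])
          fix a b assume "poly.coeff (poly.coeff f b) a \<noteq> 0"
          with f have "int (Suc d) * int L \<le> int p * int a + int q * int b"
            unfolding w_def mem_weight_ideal_iff by blast
          then have "int (Suc d * L) \<le> int (p * a + q * b)" by (simp only: of_nat_mult of_nat_add)
          then have ab: "Suc d * L \<le> p * a + q * b" by (simp only: of_nat_le_iff)
          have "\<exists>a' b'. a' \<le> a \<and> b' \<le> b \<and> d * L \<le> p * a' + q * b' \<and> L \<le> p * (a - a') + q * (b - b')"
          proof -
            consider "d = 0" | "g * q \<le> a" | "g * p \<le> b" | "0 < d" "a < g * q" "b < g * p" by linarith
            then show ?thesis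
            proof cases
              case 1
              then show ?thesis using ab by (intro exI[of _ 0]) simp
            next
              case 2
              then obtain e where "a = g * q + e" by (auto simp: le_iff_add)
              then show ?thesis using ab
                by (intro exI[of _ e] exI[of _ b]) (simp add: L_def algebra_simps)
            next
              case 3
              then obtain e where "b = g * p + e" by (auto simp: le_iff_add)
              then show ?thesis using ab
                by (intro exI[of _ a] exI[of _ e]) (simp add: L_def algebra_simps)
            next
              case 4
              then have "0 < p" "0 < q" by (cases p; cases q; simp)+
              then have "p * a + q * b < p * (g * q) + q * (g * p)"
                using 4(2,3) by (intro add_strict_mono) auto
              also have "\<dots> = 2 * L" by (simp add: L_def algebra_simps)
              also have "\<dots> \<le> Suc d * L" using 4(1) by (intro mult_le_mono1) simp
              also note ab
              finally show ?thesis by simp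
            qed
          qed
          then obtain a' b' where *: "a' \<le> a" "b' \<le> b" "d * L \<le> p * a' + q * b'"
            "L \<le> p * (a - a') + q * (b - b')" by blast
          have "monomial a' b' \<in> ?J"
            using of_nat_mono[OF *(3), where 'a = int]
            by (simp add: mem_val_ideal_iff w_def weight_monomial)
          moreover have "monomial (a - a') (b - b') \<in> ?I"
            using of_nat_mono[OF *(4), where 'a = int]
            by (simp add: mem_val_ideal_iff w_def weight_monomial del: of_nat_diff)
          ultimately have "monomial a' b' * monomial (a - a') (b - b') \<in> ideal_prod type_ring ?J ?I"
            using ideal_prod.prod[of _ ?J _ ?I type_ring] by fastforce
          then show "monomial a b \<in> ideal_prod type_ring ?J ?I"
            using *(1,2) by (simp add: mult_monom)
        qed
      qed
    qed
    then show ?case by (simp only: ideal_power_Suc Suc.IH)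
  qed
qed

text \<open>
  A solution of \<open>p a + q b = k\<close> in integers is made nonnegative by adding multiples of \<open>g q\<close> to \<open>a\<close>
  and of \<open>g p\<close> to \<open>b\<close>. Each such step adds \<open>g p q\<close> to the value, and a factor \<open>T\<close> subtracts it again.
\<close>

lemma weight_extension_surj:
  assumes "coprime p q" "0 < p" "0 < q" "0 < g"
  shows "\<exists>F :: 'a::idom poly poly poly. F \<noteq> 0 \<and> gauss (- int (g * p * q)) (weight p q) F = k"
proof -
  obtain u v where uv: "u * int p + v * int q = 1"
    using bezout_int[of "int p" "int q"] assms(1) by (auto simp flip: gcd_int_int_eq)
  define m n where "m = nat \<bar>k * u\<bar>" and "n = nat \<bar>k * v\<bar>"
  define a b where "a = k * u + int (g * q) * int m" and "b = k * v + int (g * p) * int n"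
  have *: "0 \<le> x + int c * int (nat \<bar>x\<bar>)" if "0 < c" for x c
  proof -
    have "\<bar>x\<bar> \<le> int c * \<bar>x\<bar>" using that by (simp add: mult_le_cancel_right1)
    then show ?thesis by simp
  qed
  have ab: "0 \<le> a" "0 \<le> b"
    unfolding a_def b_def m_def n_def using assms by (intro *; simp)+
  have "int p * a + int q * b = k * (u * int p + v * int q) + int (g * p * q) * int (m + n)"
    by (simp add: a_def b_def algebra_simps)
  then have "gauss (- int (g * p * q)) (weight p q)
      (monom (monomial (nat a) (nat b)) (m + n) :: 'a poly poly poly) = k"
    using ab by (simp add: gauss_monom weight_monomial uv)
  then show ?thesis by (intro exI[of _ "monom (monomial (nat a) (nat b)) (m + n)"]) simp
qed


section \<open>The normalisation\<close>

lemma var_monomial: "var_x ^ a * var_y ^ b = monomial a b"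
proof -
  have x: "var_x = monom (monom 1 1) 0" and y: "var_y = monom 1 1"
    by (simp_all add: var_x_def var_y_def monom_0 monom_Suc)
  show ?thesis unfolding x y by (simp add: monom_power mult_monom)
qed

text \<open>
  If \<open>m\<^sup>n\<close> lies in the \<open>n\<close>-th power of the ideal generated by \<open>x^(g q)\<close> and \<open>y^(g p)\<close>, both of weight
  \<open>L\<close>, then \<open>n\<close> times the weight of \<open>m\<close> is at least \<open>n L\<close>. Conversely the exponent
  \<open>n = (g q) (g p)\<close> turns every monomial into a product of powers of the two generators, and the
  weight condition says that at least \<open>n\<close> factors occur.
\<close>

lemma normal_ideal_eq:
  fixes p q g :: nat
  assumes "0 < p" "0 < q" "0 < g"
  shows "normal_ideal (g * q) (g * p) = val_ideal (weight p q) (int (g * p * q))"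
proof -
  let ?w = "weight p q :: complex poly poly \<Rightarrow> int" and ?L = "g * p * q"
  let ?K = "Idl\<^bsub>Cxy\<^esub> {var_x ^ (g * q), var_y ^ (g * p)}"
  let ?S = "{var_x ^ a * var_y ^ b | a b. \<exists>n\<ge>1. (var_x ^ a * var_y ^ b) ^ n \<in> ideal_power Cxy ?K n}"
  interpret valuation ?w by (rule valuation_weight)
  interpret cring Cxy by (rule cring_from_type_algebra)
  have K: "ideal ?K Cxy" by (intro genideal_ideal) simp
  have gen: "var_x ^ (g * q) \<in> ?K" "var_y ^ (g * p) \<in> ?K"
    using genideal_self[of "{var_x ^ (g * q), var_y ^ (g * p)}"] by simp_all
  have I: "ideal (val_ideal ?w (int ?L)) Cxy" by (rule ideal_weight) simp
  have N: "normal_ideal (g * q) (g * p) = Idl\<^bsub>Cxy\<^esub> ?S"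
    by (simp add: normal_ideal_def normalisation_def)
  have N_ideal: "ideal (Idl\<^bsub>Cxy\<^esub> ?S) Cxy" by (intro genideal_ideal) simp
  have xy: "?w (var_x ^ a) = int p * int a" "?w (var_y ^ b) = int q * int b" for a b
  proof -
    have "?w (var_x ^ a * var_y ^ b) = int p * int a + int q * int b" for a b
      by (simp only: var_monomial weight_monomial)
    from this[of a 0] this[of 0 b] show "?w (var_x ^ a) = int p * int a" "?w (var_y ^ b) = int q * int b"
      by simp_all
  qed
  have KL: "?K \<subseteq> val_ideal ?w (int ?L)"
    by (rule genideal_minimal[OF I]) (simp add: mem_val_ideal_iff xy)
  have KpL: "ideal_power Cxy ?K n \<subseteq> val_ideal ?w (int n * int ?L)" for n
  proof (induction n)
    case 0
    show ?case by (auto simp: mem_weight_ideal_iff)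
  next
    case (Suc n)
    show ?case
    proof
      fix f assume "f \<in> ideal_power Cxy ?K (Suc n)"
      then have "f \<in> ideal_prod Cxy (ideal_power Cxy ?K n) ?K" by (simp only: ideal_power_Suc)
      then show "f \<in> val_ideal ?w (int (Suc n) * int ?L)"
      proof induction
        case (prod i j)
        then show ?case using val_ideal_mult[of i "int n * int ?L" j "int ?L"] Suc KL
          by (auto simp: algebra_simps)
      qed (simp add: val_ideal_add)
    qed
  qed
  have pow: "f ^ n \<in> ideal_power Cxy ?K n" if "f \<in> ?K" for f n
  proof (induction n)
    case 0 show ?case by (simp add: ideal_power_0)
  next
    case (Suc n)
    then show ?case
      using ideal_prod.prod[of "f ^ n" _ f ?K Cxy] that by (simp add: ideal_power_Suc mult.commute)
  qed
  show ?thesis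
    unfolding N
  proof
    show "Idl\<^bsub>Cxy\<^esub> ?S \<subseteq> val_ideal ?w (int ?L)"
    proof (rule genideal_minimal[OF I], clarify)
      fix a b n assume n: "1 \<le> (n::nat)" "(var_x ^ a * var_y ^ b) ^ n \<in> ideal_power Cxy ?K n"
      have nz: "var_x ^ a * var_y ^ b \<noteq> 0" by (simp add: var_monomial)
      with n(2) KpL[of n] have "int n * int ?L \<le> ?w ((var_x ^ a * var_y ^ b) ^ n)"
        by (auto simp: mem_val_ideal_iff)
      then have "int n * int ?L \<le> int n * ?w (var_x ^ a * var_y ^ b)" by (simp only: val_power[OF nz])
      then show "var_x ^ a * var_y ^ b \<in> val_ideal ?w (int ?L)"
        using n(1) by (simp add: mem_val_ideal_iff)
    qed
    show "val_ideal ?w (int ?L) \<subseteq> Idl\<^bsub>Cxy\<^esub> ?S"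
    proof
      fix f assume f: "f \<in> val_ideal ?w (int ?L)"
      show "f \<in> Idl\<^bsub>Cxy\<^esub> ?S"
      proof (rule mem_ideal_if_monomials[OF N_ideal])
        fix a b assume "poly.coeff (poly.coeff f b) a \<noteq> 0"
        with f have "int ?L \<le> int p * int a + int q * int b"
          unfolding mem_weight_ideal_iff by blast
        then have "int ?L \<le> int (p * a + q * b)" by (simp only: of_nat_mult of_nat_add)
        then have ab: "?L \<le> p * a + q * b" by (simp only: of_nat_le_iff)
        define n where "n = g * q * (g * p)"
        \<comment> \<open>The power is \<open>x^(g q)\<close> taken \<open>g p a\<close> times and \<open>y^(g p)\<close> taken \<open>g q b\<close> times; \<open>i\<close> and
          \<open>n - i\<close> of these factors are used.\<close>
        define i where "i = min n (g * p * a)"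
        have "g * ?L \<le> g * (p * a + q * b)" using ab by (rule mult_left_mono) simp
        then have "n \<le> g * p * a + g * q * b" by (simp add: n_def algebra_simps)
        then have i: "i \<le> n" "i \<le> g * p * a" "n - i \<le> g * q * b" by (auto simp: i_def)
        let ?X = "var_x ^ (g * q)" and ?Y = "var_y ^ (g * p)"
        have "?X ^ i * ?Y ^ (n - i) \<in> ideal_power Cxy ?K n"
          using mult_mem_ideal_power[OF K pow[OF gen(1), of i] pow[OF gen(2), of "n - i"]] i(1) by simp
        then have "(?X ^ (g * p * a - i) * ?Y ^ (g * q * b - (n - i))) * (?X ^ i * ?Y ^ (n - i))
            \<in> ideal_power Cxy ?K n"
          using ideal_ideal_power[OF K, of n] unfolding ideal_type_ring_iff by blast
        also have "(?X ^ (g * p * a - i) * ?Y ^ (g * q * b - (n - i))) * (?X ^ i * ?Y ^ (n - i)) =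
            (?X ^ (g * p * a - i) * ?X ^ i) * (?Y ^ (g * q * b - (n - i)) * ?Y ^ (n - i))"
          by (simp only: mult_ac)
        also have "\<dots> = ?X ^ (g * p * a) * ?Y ^ (g * q * b)"
          using i by (simp only: power_add[symmetric] le_add_diff_inverse2)
        also have "\<dots> = (var_x ^ a * var_y ^ b) ^ n"
          by (simp add: n_def power_mult_distrib power_mult[symmetric] mult_ac)
        finally have "(var_x ^ a * var_y ^ b) ^ n \<in> ideal_power Cxy ?K n" .
        moreover have "1 \<le> n" using assms by (simp add: n_def Suc_le_eq)
        ultimately have "var_x ^ a * var_y ^ b \<in> ?S" by blast
        then show "monomial a b \<in> Idl\<^bsub>Cxy\<^esub> ?S"
          using genideal_self[of ?S] unfolding var_monomial by auto
      qed
    qed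
  qed
qed

theorem theorem2:
  fixes \<alpha> \<beta> :: nat
  assumes "\<alpha> > 0" and "\<beta> > 0"
  shows "behrend_number Cxy (normal_ideal \<alpha> \<beta>) = enat (\<alpha> * \<beta> div gcd \<alpha> \<beta>)"
proof -
  define g where "g = gcd \<alpha> \<beta>"
  obtain p q where pq: "\<alpha> = g * q" "\<beta> = g * p" "coprime q p"
    using gcd_coprime_exists[of \<alpha> \<beta>] assms unfolding g_def by (auto simp: mult.commute)
  have pos: "0 < p" "0 < q" "0 < g" using assms pq by auto
  interpret valuation "weight p q :: complex poly poly \<Rightarrow> int" by (rule valuation_weight)
  have "behrend_number Cxy (val_ideal (weight p q) (int (g * p * q))) = enat (g * p * q)"
  proof (rule behrend_number_eq)
    show "ideal (val_ideal (weight p q) (int (g * p * q))) Cxy" by (rule ideal_weight) simp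
    show "\<exists>F. F \<noteq> 0 \<and> gauss (- int (g * p * q)) (weight p q :: complex poly poly \<Rightarrow> int) F = k" for k
      using weight_extension_surj pq(3) pos by (simp add: coprime_commute)
    show "0 < g * p * q" using pos by simp
  qed (rule ideal_power_weight)
  moreover have "g * p * q = \<alpha> * \<beta> div gcd \<alpha> \<beta>"
    unfolding g_def[symmetric] using pq(1,2) pos by simp
  ultimately show ?thesis using normal_ideal_eq[OF pos] pq(1,2) by simp
qed

end
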